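(* Let $M \in M_n(\mathbb{K})$, and let $\lambda_{ij}$ ($1\le i\le r$, $1\le j\le \rho_i$) be its distinct eigenvalues and $C_{ij}(M)$ the matrices defined in the context. Then the matrices $$S(M)=\sum_{i=1}^r\sum_{j=1}^{\rho_i}\lambda_{ij}C_{ij}(M)\quad\text{and}\quad N(M)=M-S(M)$$ are polynomial expressions of $M$ and have coefficients in $\mathbb{K}^\dag$, $S(M)$ is semisimple, $N(M)$ is nilpotent, $S(M)N(M)=N(M)S(M)$ and $M=S(M)+N(M)$. Moreover, if $M=S+N$ is any decomposition with $S\in M_n(\overline{\mathbb{K}})$ semisimple, $N\in M_n(\overline{\mathbb{K}})$ nilpotent and $SN=NS$, then $S=S(M)$ and $N=N(M)$.
   Context: $\mathbb{K}$ is an arbitrary field, $\overline{\mathbb{K}}$ its algebraic closure. A square matrix is semisimple if it is diagonalizable over $\overline{\mathbb{K}}$. Let $m(X)=m_1(X)^{\mu_1}\cdots m_r(X)^{\mu_r}$ be the minimal polynomial of $M$ over $\mathbb{K}$, with $\mu_i>0$ and $m_1,\dots,m_r$ mutually distinct (monic) irreducible polynomials in $\mathbb{K}[X]$. If $0$ is an eigenvalue of $M$, the factors are ordered so that $m_r(X)=X$. $\mathbb{F}\subseteq\overline{\mathbb{K}}$ is the splitting field of $m(X)$ over $\mathbb{K}$, and $\mathbb{K}^\dag$ is the fixed field of the group $Aut(\mathbb{F}/\mathbb{K})$ of automorphisms of $\mathbb{F}$ fixing $\mathbb{K}$ elementwise. For each $i$, $\lambda_{i1},\dots,\lambda_{i\rho_i}$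 are the distinct roots of $m_i(X)$ in $\mathbb{F}$. One has $m(X)=\prod_{i=1}^r\prod_{j=1}^{\rho_i}(X-\lambda_{ij})^{\eta_i}$ for suitable integers $\eta_i\ge\mu_i$ (independent of $j$). Put $G_{ij}(X)=m(X)/(X-\lambda_{ij})^{\eta_i}$. There is a unique family of polynomials $B_{ij}(X)\in\mathbb{K}(\lambda_{i1},\dots,\lambda_{i\rho_i})[X]$ with $\deg B_{ij}<\eta_i$ and $\sum_{i=1}^r\sum_{j=1}^{\rho_i}B_{ij}(X)G_{ij}(X)=1$; put $C_{ij}(X)=B_{ij}(X)G_{ij}(X)$. *)

theory Defs
  imports
    "HOL-Algebra.Algebraic_Closure_Type"
    "HOL-Algebra.Generated_Fields"
    "Jordan_Normal_Form.Jordan_Normal_Form"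
begin

text \<open>
  The base field is an arbitrary type \<open>'a :: field\<close>; its algebraic closure is the library type
  \<open>'a alg_closure\<close>, with embedding \<open>to_ac\<close>. Matrices and polynomials over the base field are
  transported to the closure by \<open>map_mat to_ac\<close> and \<open>map_poly to_ac\<close>.
\<close>

definition poly_mat :: "'a :: field poly \<Rightarrow> 'a mat \<Rightarrow> 'a mat" where
  "poly_mat p A = finsum (ring_mat TYPE('a) (dim_row A) ())
     (\<lambda>k. Polynomial.coeff p k \<cdot>\<^sub>m (A ^\<^sub>m k)) {..Polynomial.degree p}"

definition minimal_polynomial :: "'a :: field mat \<Rightarrow> 'a poly" where
  "minimal_polynomial A = (THE p.
     Polynomial.lead_coeff p = 1 \<and>
     poly_mat p A = 0\<^sub>m (dim_row A) (dim_row A) \<and>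
     (\<forall>q. q \<noteq> 0 \<and> poly_mat q A = 0\<^sub>m (dim_row A) (dim_row A)
        \<longrightarrow> Polynomial.degree p \<le> Polynomial.degree q))"

definition semisimple_mat :: "'a :: field alg_closure mat \<Rightarrow> bool" where
  "semisimple_mat A \<longleftrightarrow> (\<exists>D. diagonal_mat D \<and> similar_mat A D)"

definition nilpotent_mat :: "'a :: field mat \<Rightarrow> bool" where
  "nilpotent_mat A \<longleftrightarrow> (\<exists>k. A ^\<^sub>m k = 0\<^sub>m (dim_row A) (dim_row A))"

definition adjoin :: "'a :: field alg_closure set \<Rightarrow> 'a alg_closure set" where
  "adjoin A = generate_field ring_of_type_algebra (range to_ac \<union> A)"

definition roots_ac :: "'a :: field poly \<Rightarrow> 'a alg_closure set" where
  "roots_ac p = {x. poly (map_poly to_ac p) x = 0}"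

definition splitting_field :: "'a :: field poly \<Rightarrow> 'a alg_closure set" where
  "splitting_field p = adjoin (roots_ac p)"

text \<open>
  Automorphisms of a subfield are represented by total functions on the closure; their values
  outside the subfield are arbitrary and irrelevant.
\<close>

definition automorphisms_over_base ::
  "'a :: field alg_closure set \<Rightarrow> ('a alg_closure \<Rightarrow> 'a alg_closure) set" where
  "automorphisms_over_base F =
     {\<sigma> \<in> ring_iso (ring_of_type_algebra\<lparr>carrier := F\<rparr>) (ring_of_type_algebra\<lparr>carrier := F\<rparr>).
        \<forall>x. \<sigma> (to_ac x) = to_ac x}"

definition K_dagger :: "'a :: field mat \<Rightarrow> 'a alg_closure set" where
  "K_dagger M = (let F = splitting_field (minimal_polynomial M) in
     {x \<in> F. \<forall>\<sigma> \<in> automorphisms_over_base F. \<sigma> x = x})"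

text \<open>
  Instead of being enumerated by pairs \<open>(i, j)\<close>, the families are indexed by the pairs
  \<open>(q, \<alpha>)\<close> with \<open>q = m\<^sub>i\<close> a monic irreducible factor of the minimal polynomial \<open>m\<close> and
  \<open>\<alpha> = \<lambda>\<^sub>i\<^sub>j\<close> a root of \<open>q\<close>.
\<close>

definition min_factors :: "'a :: field mat \<Rightarrow> 'a poly set" where
  "min_factors M = {q. irreducible q \<and> Polynomial.lead_coeff q = 1 \<and> q dvd minimal_polynomial M}"

text \<open>\<open>\<eta>\<close> is the exponent of \<open>X - \<alpha>\<close> in the factorisation of \<open>m\<close> over the closure;
  it takes the same value at all roots of a given \<open>q\<close>.\<close>

definition eta :: "'a :: field mat \<Rightarrow> 'a alg_closure \<Rightarrow> nat" where
  "eta M \<alpha> = Polynomial.order \<alpha> (map_poly to_ac (minimal_polynomial M))"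

definition G_poly :: "'a :: field mat \<Rightarrow> 'a alg_closure \<Rightarrow> 'a alg_closure poly" where
  "G_poly M \<alpha> = map_poly to_ac (minimal_polynomial M) div [:- \<alpha>, 1:] ^ eta M \<alpha>"

text \<open>Setting \<open>B\<close> to zero off the index set makes the family unique as a total function.\<close>

definition B_poly :: "'a :: field mat \<Rightarrow> 'a poly \<Rightarrow> 'a alg_closure \<Rightarrow> 'a alg_closure poly" where
  "B_poly M = (THE B.
     (\<forall>q \<in> min_factors M. \<forall>\<alpha> \<in> roots_ac q.
        (\<forall>k. Polynomial.coeff (B q \<alpha>) k \<in> adjoin (roots_ac q)) \<and>
        Polynomial.degree (B q \<alpha>) < eta M \<alpha>) \<and>
     (\<Sum>q \<in> min_factors M. \<Sum>\<alpha> \<in> roots_ac q. B q \<alpha> * G_poly M \<alpha>) = 1 \<and>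
     (\<forall>q \<alpha>. \<not> (q \<in> min_factors M \<and> \<alpha> \<in> roots_ac q) \<longrightarrow> B q \<alpha> = 0))"

definition C_poly :: "'a :: field mat \<Rightarrow> 'a poly \<Rightarrow> 'a alg_closure \<Rightarrow> 'a alg_closure poly" where
  "C_poly M q \<alpha> = B_poly M q \<alpha> * G_poly M \<alpha>"

definition S_part :: "'a :: field mat \<Rightarrow> 'a alg_closure mat" where
  "S_part M = (let R = ring_mat TYPE('a alg_closure) (dim_row M) () in
     finsum R (\<lambda>q. finsum R (\<lambda>\<alpha>. \<alpha> \<cdot>\<^sub>m poly_mat (C_poly M q \<alpha>) (map_mat to_ac M)) (roots_ac q))
       (min_factors M))"

definition N_part :: "'a :: field mat \<Rightarrow> 'a alg_closure mat" where
  "N_part M = map_mat to_ac M - S_part M"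

end

theory Submission
  imports Defs "Jordan_Normal_Form.DL_Rank"
begin

text \<open>Write \<open>m\<close> for the minimal polynomial of \<open>M\<close> and \<open>A\<close> for \<open>M\<close> with entries in the closure. Everything follows
from one polynomial \<open>s\<close>, called \<open>s_poly\<close> below, with \<open>S_part M = s(A)\<close>: by the Chinese remainder theorem it is
the only polynomial of degree less than that of \<open>m\<close> with \<open>s \<equiv> a\<close> modulo \<open>(X - a)^\<eta>\<close> for every root \<open>a\<close> of
\<open>m\<close> in the closure, where \<open>\<eta>\<close> is the multiplicity of \<open>a\<close> (lemmas \<open>B_poly\<close>, \<open>s_poly_cong\<close>, \<open>s_poly_degree\<close>). The
degenerate case \<open>m = 1\<close>, which occurs for matrices of size zero, gives \<open>s = 0\<close>.

The coefficients of \<open>s\<close> lie in the splitting field. An automorphism \<open>\<sigma>\<close> over the base field preserves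
multiplicities and permutes the roots of \<open>m\<close>, so it maps the congruence at \<open>a\<close> to the congruence at
\<open>\<sigma> a\<close>. By uniqueness \<open>s\<close> is fixed by \<open>\<sigma>\<close> (lemma \<open>fixed_by_endo\<close>), so it has coefficients in \<open>K_dagger M\<close>.

The two structural claims are divisibilities by \<open>m\<close>, which may be checked at each root separately (lemma
\<open>dvd_if_order_le\<close>). First, \<open>X - s\<close> vanishes at each root, so \<open>m\<close> divides a power of it and \<open>A - s(A)\<close> is
nilpotent. Second, \<open>m\<close> divides the product of the \<open>s - a\<close> over all roots \<open>a\<close>, so \<open>s(A)\<close> is annihilated by a product
of distinct linear factors and is therefore diagonalisable (lemma \<open>diagonalisable_if_split\<close>). Commutation is
clear for polynomials in \<open>A\<close>.

For uniqueness, let \<open>A = S + N\<close> be another decomposition and \<open>v\<close> an eigenvector of \<open>S\<close> for \<open>a\<close>. On \<open>v\<close> the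
powers of \<open>A - a\<close> act like those of \<open>N\<close>, so \<open>v\<close> is a generalised eigenvector of \<open>A\<close>, on which \<open>s(A)\<close> is
the scalar \<open>a\<close>. Hence \<open>S\<close> and \<open>s(A)\<close> agree on the eigenvectors of \<open>S\<close>, which span (lemma
\<open>semisimple_part_unique\<close>).\<close>

section \<open>Polynomials over a subfield\<close>

text \<open>A subfield of a field given as a type, expressed with the type class operations so that it
combines directly with the polynomials of the type \<open>'a poly\<close>.\<close>

definition is_subfield :: "'a :: field set \<Rightarrow> bool" where
  "is_subfield F \<longleftrightarrow> 1 \<in> F \<and> (\<forall>x\<in>F. - x \<in> F \<and> inverse x \<in> F)
     \<and> (\<forall>x\<in>F. \<forall>y\<in>F. x + y \<in> F \<and> x * y \<in> F)"

lemma is_subfield_closed: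
  assumes "is_subfield F"
  shows "0 \<in> F" "1 \<in> F" "x \<in> F \<Longrightarrow> - x \<in> F" "x \<in> F \<Longrightarrow> inverse x \<in> F"
    "x \<in> F \<Longrightarrow> y \<in> F \<Longrightarrow> x + y \<in> F" "x \<in> F \<Longrightarrow> y \<in> F \<Longrightarrow> x * y \<in> F"
    "x \<in> F \<Longrightarrow> y \<in> F \<Longrightarrow> x - y \<in> F" "x \<in> F \<Longrightarrow> y \<in> F \<Longrightarrow> x / y \<in> F"
proof -
  have *: "1 \<in> F" "\<And>x. x \<in> F \<Longrightarrow> - x \<in> F" "\<And>x. x \<in> F \<Longrightarrow> inverse x \<in> F"
    "\<And>x y. x \<in> F \<Longrightarrow> y \<in> F \<Longrightarrow> x + y \<in> F" "\<And>x y. x \<in> F \<Longrightarrow> y \<in> F \<Longrightarrow> x * y \<in> F"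
    using assms unfolding is_subfield_def by auto
  have "1 + (- 1) \<in> F" using * by blast
  then show "0 \<in> F" by simp
  show "1 \<in> F" "x \<in> F \<Longrightarrow> - x \<in> F" "x \<in> F \<Longrightarrow> inverse x \<in> F"
    "x \<in> F \<Longrightarrow> y \<in> F \<Longrightarrow> x + y \<in> F" "x \<in> F \<Longrightarrow> y \<in> F \<Longrightarrow> x * y \<in> F" using * by auto
  show "x \<in> F \<Longrightarrow> y \<in> F \<Longrightarrow> x - y \<in> F" using *(2)[of y] *(4)[of x "- y"] by simp
  show "x \<in> F \<Longrightarrow> y \<in> F \<Longrightarrow> x / y \<in> F" using *(3)[of y] *(5)[of x "inverse y"]
    by (simp add: field_class.field_divide_inverse)
qed

lemma is_subfield_sum:
  "is_subfield F \<Longrightarrow> (\<And>i. i \<in> I \<Longrightarrow> f i \<in> F) \<Longrightarrow> sum f I \<in> F"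
  by (induction I rule: infinite_finite_induct) (auto intro: is_subfield_closed)

abbreviation polys_over :: "'a :: field set \<Rightarrow> 'a poly set" where
  "polys_over F \<equiv> {p. \<forall>k. coeff p k \<in> F}"

lemma polys_over_closed:
  assumes "is_subfield F"
  shows "1 \<in> polys_over F"
    and "a \<in> F \<Longrightarrow> [:a:] \<in> polys_over F"
    and "a \<in> F \<Longrightarrow> p \<in> polys_over F \<Longrightarrow> pCons a p \<in> polys_over F"
    and "p \<in> polys_over F \<Longrightarrow> q \<in> polys_over F \<Longrightarrow> p + q \<in> polys_over F"
    and "p \<in> polys_over F \<Longrightarrow> q \<in> polys_over F \<Longrightarrow> p - q \<in> polys_over F"
    and "p \<in> polys_over F \<Longrightarrow> q \<in> polys_over F \<Longrightarrow> p * q \<in> polys_over F"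
    and "a \<in> F \<Longrightarrow> p \<in> polys_over F \<Longrightarrow> smult a p \<in> polys_over F"
proof -
  note c = is_subfield_closed[OF assms]
  show one: "1 \<in> polys_over F" and "a \<in> F \<Longrightarrow> [:a:] \<in> polys_over F"
    and "a \<in> F \<Longrightarrow> p \<in> polys_over F \<Longrightarrow> pCons a p \<in> polys_over F"
    by (auto simp: coeff_pCons c one_pCons split: nat.splits)
  show "p \<in> polys_over F \<Longrightarrow> q \<in> polys_over F \<Longrightarrow> p + q \<in> polys_over F"
    "p \<in> polys_over F \<Longrightarrow> q \<in> polys_over F \<Longrightarrow> p - q \<in> polys_over F"
    "a \<in> F \<Longrightarrow> p \<in> polys_over F \<Longrightarrow> smult a p \<in> polys_over F"
    by (auto simp: c)
  show "p \<in> polys_over F \<Longrightarrow> q \<in> polys_over F \<Longrightarrow> p * q \<in> polys_over F"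
    by (auto simp: coeff_mult c intro!: is_subfield_sum[OF assms])
qed

lemma polys_over_sum:
  "is_subfield F \<Longrightarrow> (\<And>i. i \<in> I \<Longrightarrow> f i \<in> polys_over F) \<Longrightarrow> sum f I \<in> polys_over F"
  by (auto simp: coeff_sum intro!: is_subfield_sum)

lemma polys_over_power:
  "is_subfield F \<Longrightarrow> p \<in> polys_over F \<Longrightarrow> p ^ n \<in> polys_over F"
proof (induction n)
  case 0
  show ?case unfolding power_0 by (rule polys_over_closed(1)[OF 0(1)])
next
  case (Suc n)
  then show ?case using polys_over_closed(6)[of F p "p ^ n"] by simp
qed

lemma poly_in_subfield:
  assumes "is_subfield F" "p \<in> polys_over F" "x \<in> F"
  shows "poly p x \<in> F"
  unfolding poly_altdef
proof (rule is_subfield_sum[OF assms(1)])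
  fix i
  have "x ^ i \<in> F" by (induction i) (auto intro: is_subfield_closed[OF assms(1)] assms(3))
  then show "coeff p i * x ^ i \<in> F" using assms(2) by (auto intro: is_subfield_closed[OF assms(1)])
qed

text \<open>The coefficients of quotient and remainder are obtained from those of the two polynomials by
field operations, as the recursion of polynomial division along the coefficient list shows.\<close>

lemma polys_over_div_mod:
  assumes F: "is_subfield F" and q: "q \<in> polys_over F" and p: "p \<in> polys_over F"
  shows "p div q \<in> polys_over F \<and> p mod q \<in> polys_over F"
  using p
proof (induction p rule: pCons_induct)
  case 0
  then show ?case by simp
next
  case (pCons a p)
  have a: "a \<in> F" using pCons.prems[unfolded mem_Collect_eq, rule_format, of 0] by simp
  have "p \<in> polys_over F"
  proof (clarify)
    fix k show "coeff p k \<in> F" using pCons.prems[unfolded mem_Collect_eq, rule_format, of "Suc k"] by simp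
  qed
  with pCons.IH have IH: "p div q \<in> polys_over F" "p mod q \<in> polys_over F" by auto
  define c where "c = coeff (pCons a (p mod q)) (degree q) / lead_coeff q"
  have pc: "pCons a (p mod q) \<in> polys_over F" by (rule polys_over_closed(3)[OF F a IH(2)])
  have c: "c \<in> F" unfolding c_def
    by (rule is_subfield_closed(8)[OF F]) (use pc q in auto)
  show ?case
  proof (cases "q = 0")
    case True
    then show ?thesis using pCons.prems is_subfield_closed(1)[OF F] by simp
  next
    case False
    have "pCons a p div q = pCons c (p div q)"
      "pCons a p mod q = pCons a (p mod q) - smult c q"
      unfolding c_def using False by (simp_all add: div_pCons_eq mod_pCons_eq)
    then show ?thesis
      using polys_over_closed(3)[OF F c IH(1)]
        polys_over_closed(5)[OF F pc polys_over_closed(7)[OF F c q]] by simp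
  qed
qed

lemma polys_over_linear_power:
  "is_subfield F \<Longrightarrow> a \<in> F \<Longrightarrow> [:- a, 1:] ^ k \<in> polys_over F"
  by (intro polys_over_power polys_over_closed(2,3) is_subfield_closed(2,3)) auto

section \<open>Congruences modulo powers of linear factors\<close>

text \<open>Explicit local inverses. With \<open>c = 1 / G(a)\<close>, the polynomial \<open>H = 1 - c G\<close> vanishes at \<open>a\<close>, so
modulo \<open>(X - a)^k\<close> it is nilpotent and \<open>c G = 1 - H\<close> is inverted by the geometric sum of the
powers of \<open>H\<close>. This formula shows that the coefficients of the inverse stay in the subfield.\<close>

lemma inverse_mod_linear_power:
  fixes G :: "'a :: field poly"
  assumes F: "is_subfield F" and G: "G \<in> polys_over F" and a: "a \<in> F"
    and ne: "poly G a \<noteq> 0" and k: "k > 0"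
  shows "\<exists>B \<in> polys_over F. degree B < k \<and> [:- a, 1:] ^ k dvd B * G - 1"
proof -
  define c where "c = inverse (poly G a)"
  define H where "H = 1 - smult c G"
  define B0 where "B0 = smult c (\<Sum>i<k. H ^ i)"
  define D where "D = [:- a, 1:] ^ k"
  have c: "c \<in> F" unfolding c_def
    by (rule is_subfield_closed(4)[OF F poly_in_subfield[OF F G a]])
  have H: "H \<in> polys_over F" unfolding H_def
    by (rule polys_over_closed(5)[OF F polys_over_closed(1)[OF F] polys_over_closed(7)[OF F c G]])
  have B0: "B0 \<in> polys_over F" unfolding B0_def
    by (rule polys_over_closed(7)[OF F c polys_over_sum[OF F polys_over_power[OF F H]]])
  \<comment> \<open>Reducing \<open>B0\<close> modulo \<open>D\<close> achieves the degree bound without changing the congruence.\<close>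
  have "poly H a = 0" unfolding H_def c_def using ne by simp
  then have dvd: "D dvd H ^ k" unfolding D_def by (simp add: poly_eq_0_iff_dvd dvd_power_same)
  have "B0 * G = (\<Sum>i<k. H ^ i) * (1 - H)" unfolding B0_def H_def by simp
  also have "\<dots> = 1 - H ^ k" by (simp add: one_diff_power_eq mult.commute)
  finally have "D dvd B0 * G - 1" using dvd by simp
  then have "D dvd (B0 * G - 1) - D * (B0 div D * G)" by (rule dvd_diff[OF _ dvd_triv_left])
  moreover have "B0 mod D * G - 1 = (B0 * G - 1) - D * (B0 div D * G)"
    by (simp add: minus_div_mult_eq_mod[symmetric] algebra_simps)
  ultimately have "D dvd B0 mod D * G - 1" by (simp only:)
  moreover have D0: "D \<noteq> 0" "degree D = k" unfolding D_def
    by (auto simp: degree_power_eq)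
  moreover have "degree (B0 mod D) < k"
    using degree_mod_less[OF D0(1), of B0] D0 k by auto
  moreover have "B0 mod D \<in> polys_over F"
    using polys_over_div_mod[OF F _ B0, of D] polys_over_linear_power[OF F a] unfolding D_def by auto
  ultimately show ?thesis unfolding D_def by blast
qed

text \<open>Over an algebraically closed field, divisibility by \<open>m\<close> may be tested at one root of \<open>m\<close> at a time:
\<open>m\<close> is, up to a constant, the product of the pairwise coprime powers \<open>(X - a) ^ order a m\<close>. This is
the form in which the Chinese remainder theorem is used below.\<close>

lemma dvd_if_order_le:
  fixes m t :: "'a :: alg_closed_field poly"
  assumes "m \<noteq> 0" "\<And>a. [:- a, 1:] ^ order a m dvd t"
  shows "m dvd t"
  using assms
proof (induction m arbitrary: t rule: poly_root_order_induct)
  case 0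
  then show ?case by simp
next
  case (no_roots p)
  have "degree p = 0" using no_roots(1) alg_closed_imp_poly_has_root by blast
  then show ?case using no_roots(2) by (auto simp: is_unit_iff_degree intro: unit_imp_dvd)
next
  case (root p x n)
  have p0: "p \<noteq> 0" using root.prems by auto
  have ordp: "order a ([:- x, 1:] ^ n * p) = order a ([:- x, 1:] ^ n) + order a p" for a
    by (rule order_mult) (use root.prems(1) in auto)
  have ox: "order x ([:- x, 1:] ^ n) = n" by (rule order_power_n_n)
  have o0: "order a ([:- x, 1:] ^ n) = 0" if "a \<noteq> x" for a
    using that by (intro order_0I) auto
  have "order x p = 0" using root.hyps by (simp add: order_0I)
  then have "[:- x, 1:] ^ n dvd t" using root.prems(2)[of x] ordp[of x] ox by simp
  then obtain t' where t': "t = [:- x, 1:] ^ n * t'" by auto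
  have "p dvd t'"
  proof (rule root.IH[OF p0])
    fix a
    show "[:- a, 1:] ^ order a p dvd t'"
    proof (cases "a = x \<or> t' = 0")
      case True
      then show ?thesis using \<open>order x p = 0\<close> by auto
    next
      case False
      then have t0: "t \<noteq> 0" using t' by simp
      have "order a p \<le> order a t"
        using root.prems(2)[of a] ordp[of a] o0[of a] False t0 by (simp add: order_divides)
      also have "order a t = order a t'" unfolding t'
        using order_mult[of "[:- x, 1:] ^ n" t' a] o0[of a] False t0 t' by simp
      finally show ?thesis using False by (simp add: order_divides)
    qed
  qed
  then show ?case unfolding t' by (rule mult_dvd_mono[OF dvd_refl])
qed

section \<open>Field automorphisms acting on polynomials\<close>

text \<open>A homomorphism of the subfield \<open>F\<close> into itself, given by a total function whose values outside \<open>F\<close>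
are arbitrary. It acts on polynomials over \<open>F\<close> through their coefficients.\<close>

definition field_endo :: "'a :: field set \<Rightarrow> ('a \<Rightarrow> 'a) \<Rightarrow> bool" where
  "field_endo F \<sigma> \<longleftrightarrow> inj_on \<sigma> F \<and> \<sigma> ` F \<subseteq> F \<and> \<sigma> 1 = 1 \<and>
     (\<forall>x\<in>F. \<forall>y\<in>F. \<sigma> (x + y) = \<sigma> x + \<sigma> y \<and> \<sigma> (x * y) = \<sigma> x * \<sigma> y)"

context
  fixes F :: "'a :: field set" and \<sigma> :: "'a \<Rightarrow> 'a"
  assumes F: "is_subfield F" and \<sigma>: "field_endo F \<sigma>"
begin

lemma field_endo_simps:
  shows "\<sigma> 0 = 0" "\<sigma> 1 = 1"
    "x \<in> F \<Longrightarrow> y \<in> F \<Longrightarrow> \<sigma> (x + y) = \<sigma> x + \<sigma> y"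
    "x \<in> F \<Longrightarrow> y \<in> F \<Longrightarrow> \<sigma> (x * y) = \<sigma> x * \<sigma> y"
    "x \<in> F \<Longrightarrow> \<sigma> (- x) = - \<sigma> x"
    "x \<in> F \<Longrightarrow> y \<in> F \<Longrightarrow> \<sigma> (x - y) = \<sigma> x - \<sigma> y"
    "x \<in> F \<Longrightarrow> \<sigma> x = 0 \<longleftrightarrow> x = 0"
proof -
  note c = is_subfield_closed[OF F]
  have add: "\<And>x y. x \<in> F \<Longrightarrow> y \<in> F \<Longrightarrow> \<sigma> (x + y) = \<sigma> x + \<sigma> y"
    and mult: "\<And>x y. x \<in> F \<Longrightarrow> y \<in> F \<Longrightarrow> \<sigma> (x * y) = \<sigma> x * \<sigma> y"
    and one: "\<sigma> 1 = 1" and inj: "inj_on \<sigma> F" using \<sigma> unfolding field_endo_def by auto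
  have "\<sigma> 0 = \<sigma> 0 + \<sigma> 0" using add[OF c(1) c(1)] by (simp only: add_0_left)
  then show z: "\<sigma> 0 = 0" by (simp only: add_cancel_right_right)
  have neg: "\<sigma> (- x) = - \<sigma> x" if "x \<in> F" for x
    using add[OF that c(3)[OF that]] z by (simp add: eq_neg_iff_add_eq_0 add.commute)
  then show "x \<in> F \<Longrightarrow> \<sigma> (- x) = - \<sigma> x" .
  show "x \<in> F \<Longrightarrow> y \<in> F \<Longrightarrow> \<sigma> (x - y) = \<sigma> x - \<sigma> y"
    using add[of x "- y"] neg[of y] c(3)[of y] by simp
  show "x \<in> F \<Longrightarrow> \<sigma> x = 0 \<longleftrightarrow> x = 0" using inj_onD[OF inj, of x 0] z c(1) by auto
  show "\<sigma> 1 = 1" "x \<in> F \<Longrightarrow> y \<in> F \<Longrightarrow> \<sigma> (x + y) = \<sigma> x + \<sigma> y"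
    "x \<in> F \<Longrightarrow> y \<in> F \<Longrightarrow> \<sigma> (x * y) = \<sigma> x * \<sigma> y" by (fact one, (fact add mult)+)
qed

lemma field_endo_sum:
  "(\<And>i. i \<in> I \<Longrightarrow> f i \<in> F) \<Longrightarrow> \<sigma> (sum f I) = (\<Sum>i\<in>I. \<sigma> (f i))"
  by (induction I rule: infinite_finite_induct)
    (auto simp: field_endo_simps is_subfield_sum[OF F])

lemma map_poly_endo_ring:
  shows "p \<in> polys_over F \<Longrightarrow> q \<in> polys_over F \<Longrightarrow> map_poly \<sigma> (p + q) = map_poly \<sigma> p + map_poly \<sigma> q"
    "p \<in> polys_over F \<Longrightarrow> q \<in> polys_over F \<Longrightarrow> map_poly \<sigma> (p - q) = map_poly \<sigma> p - map_poly \<sigma> q"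
    "p \<in> polys_over F \<Longrightarrow> q \<in> polys_over F \<Longrightarrow> map_poly \<sigma> (p * q) = map_poly \<sigma> p * map_poly \<sigma> q"
  by (rule poly_eqI; simp add: coeff_map_poly coeff_mult field_endo_simps field_endo_sum
        is_subfield_closed[OF F])+

lemma map_poly_endo_linear_power:
  assumes "a \<in> F"
  shows "map_poly \<sigma> ([:- a, 1:] ^ k) = [:- \<sigma> a, 1:] ^ k"
proof (induction k)
  case 0
  then show ?case by (simp add: Polynomial.map_poly_pCons field_endo_simps one_pCons)
next
  case (Suc k)
  have 1: "[:- a, 1:] \<in> polys_over F" using polys_over_linear_power[OF F assms, of 1] by simp
  have "map_poly \<sigma> [:- a, 1:] = [:- \<sigma> a, 1:]"
    using assms by (simp add: Polynomial.map_poly_pCons field_endo_simps)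
  then show ?case
    using map_poly_endo_ring(3)[OF 1 polys_over_linear_power[OF F assms, of k]] Suc by simp
qed

lemma poly_map_poly_endo:
  assumes "p \<in> polys_over F" "a \<in> F"
  shows "poly (map_poly \<sigma> p) (\<sigma> a) = \<sigma> (poly p a)"
  using assms(1)
proof (induction p rule: pCons_induct)
  case 0
  then show ?case by (simp add: field_endo_simps)
next
  case (pCons b p)
  have b: "b \<in> F" using pCons.prems[unfolded mem_Collect_eq, rule_format, of 0] by simp
  have p: "p \<in> polys_over F"
  proof (clarify)
    fix k show "coeff p k \<in> F" using pCons.prems[unfolded mem_Collect_eq, rule_format, of "Suc k"] by simp
  qed
  have "poly p a \<in> F" by (rule poly_in_subfield[OF F p assms(2)])
  moreover have "map_poly \<sigma> (pCons b p) = pCons (\<sigma> b) (map_poly \<sigma> p)"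
    by (rule Polynomial.map_poly_pCons[where f = \<sigma>, OF field_endo_simps(1)])
  ultimately show ?case using pCons.IH[OF p] b assms(2)
    by (simp add: field_endo_simps is_subfield_closed[OF F])
qed

text \<open>Applying \<open>\<sigma>\<close> to the factorisation \<open>m = (X - a)^k G\<close> with \<open>G(a) \<noteq> 0\<close> gives such a
factorisation at \<open>\<sigma> a\<close>, because \<open>m\<close> is fixed and \<open>\<sigma>\<close> is injective. Hence conjugate roots
have equal multiplicities.\<close>

lemma order_endo:
  assumes m: "m \<in> polys_over F" "map_poly \<sigma> m = m" "m \<noteq> 0" and a: "a \<in> F"
  shows "order (\<sigma> a) m = order a m"
proof -
  define k where "k = order a m"
  define D where "D = [:- a, 1:] ^ k"
  define G where "G = m div D"
  have D: "D \<in> polys_over F" unfolding D_def by (rule polys_over_linear_power[OF F a])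
  have D0: "D \<noteq> 0" unfolding D_def by simp
  have G: "G \<in> polys_over F" unfolding G_def using polys_over_div_mod[OF F D m(1)] by simp
  have mDG: "m = D * G" unfolding G_def D_def k_def using order_1[of a m] by simp
  have Ga: "poly G a \<noteq> 0"
  proof
    assume "poly G a = 0"
    then have "[:- a, 1:] dvd G" by (simp add: poly_eq_0_iff_dvd)
    then have "[:- a, 1:] ^ Suc k dvd m" unfolding mDG D_def
      by (simp only: power_Suc2 mult_dvd_mono dvd_refl)
    then show False using order_2[OF m(3), of a] unfolding k_def by simp
  qed
  have "m = [:- \<sigma> a, 1:] ^ k * map_poly \<sigma> G"
    using map_poly_endo_ring(3)[OF D G] map_poly_endo_linear_power[OF a, of k] m(2) mDG D_def by simp
  moreover have "poly (map_poly \<sigma> G) (\<sigma> a) \<noteq> 0"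
    using poly_map_poly_endo[OF G a] Ga poly_in_subfield[OF F G a] by (simp add: field_endo_simps)
  ultimately show ?thesis
    using order_mult[of "[:- \<sigma> a, 1:] ^ k" "map_poly \<sigma> G" "\<sigma> a"] m(3)
    by (simp add: order_power_n_n order_0I k_def)
qed

end

text \<open>A Galois argument. The polynomial \<open>s\<close> is determined by its degree bound and by the residues
\<open>s \<equiv> a\<close> modulo \<open>(X - a) ^ order a m\<close> at the roots \<open>a\<close> of \<open>m\<close>. Applying \<open>\<sigma>\<close> turns the condition at
\<open>a\<close> into the condition at \<open>\<sigma> a\<close>; since \<open>\<sigma>\<close> permutes the roots, the whole system of congruences is
preserved, and \<open>s\<close> is fixed.\<close>

lemma fixed_by_endo:
  fixes m s :: "'a :: alg_closed_field poly"
  assumes F: "is_subfield F" and \<sigma>: "field_endo F \<sigma>"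
    and m: "m \<in> polys_over F" "map_poly \<sigma> m = m" "m \<noteq> 0" and roots: "{a. poly m a = 0} \<subseteq> F"
    and s: "s \<in> polys_over F" "s = 0 \<or> degree s < degree m"
    and cong: "\<And>a. poly m a = 0 \<Longrightarrow> [:- a, 1:] ^ order a m dvd s - [:a:]"
  shows "map_poly \<sigma> s = s"
proof -
  define R where "R = {a. poly m a = 0}"
  have RF: "R \<subseteq> F" using roots R_def by simp
  have fin: "finite R" unfolding R_def using poly_roots_finite m(3) by blast
  have sub: "\<sigma> ` R \<subseteq> R"
  proof
    fix b assume "b \<in> \<sigma> ` R"
    then obtain a where a: "a \<in> R" "b = \<sigma> a" by auto
    have "poly m (\<sigma> a) = \<sigma> (poly m a)" using poly_map_poly_endo[OF F \<sigma> m(1)] m(2) a RF by auto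
    then show "b \<in> R" using a field_endo_simps(1)[OF F \<sigma>] by (simp add: R_def)
  qed
  have inj: "inj_on \<sigma> R" using \<sigma> RF unfolding field_endo_def by (auto intro: inj_on_subset)
  have surj: "\<sigma> ` R = R" by (rule endo_inj_surj[OF fin sub inj])
  have "m dvd map_poly \<sigma> s - s"
  proof (rule dvd_if_order_le[OF m(3)])
    fix b
    show "[:- b, 1:] ^ order b m dvd map_poly \<sigma> s - s"
    proof (cases "b \<in> R")
      case False
      then show ?thesis by (simp add: R_def order_0I)
    next
      case True
      then obtain a where a: "a \<in> R" "b = \<sigma> a" using surj by auto
      have aF: "a \<in> F" using a RF by auto
      define k where "k = order a m"
      define D where "D = [:- a, 1:] ^ k"
      have D: "D \<in> polys_over F" unfolding D_def by (rule polys_over_linear_power[OF F aF])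
      have kb: "order b m = k" unfolding k_def a(2) by (rule order_endo[OF F \<sigma> m aF])
      have "D dvd s - [:a:]" unfolding D_def k_def using cong a by (auto simp: R_def)
      then obtain h where h: "s - [:a:] = D * h" by (elim dvdE)
      have sa: "s - [:a:] \<in> polys_over F"
        by (rule polys_over_closed(5)[OF F s(1) polys_over_closed(2)[OF F aF]])
      have D0: "D \<noteq> 0" unfolding D_def by simp
      have "h = (s - [:a:]) div D" unfolding h using D0 by simp
      then have hF: "h \<in> polys_over F" using polys_over_div_mod[OF F D sa] by simp
      have "map_poly \<sigma> s - [:b:] = map_poly \<sigma> (s - [:a:])"
        using map_poly_endo_ring(2)[OF F \<sigma> s(1) polys_over_closed(2)[OF F aF]]
        by (simp add: Polynomial.map_poly_pCons field_endo_simps[OF F \<sigma>] a(2))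
      also have "\<dots> = [:- b, 1:] ^ k * map_poly \<sigma> h"
        unfolding h map_poly_endo_ring(3)[OF F \<sigma> D hF]
        using map_poly_endo_linear_power[OF F \<sigma> aF, of k] a(2) D_def by simp
      finally have "[:- b, 1:] ^ k dvd map_poly \<sigma> s - [:b:]" by simp
      moreover have "[:- b, 1:] ^ k dvd s - [:b:]" using cong[of b] True kb by (simp add: R_def)
      ultimately have "[:- b, 1:] ^ k dvd (map_poly \<sigma> s - [:b:]) - (s - [:b:])" by (rule dvd_diff)
      then show ?thesis using kb by simp
    qed
  qed
  moreover have "map_poly \<sigma> s - s = 0 \<or> degree (map_poly \<sigma> s - s) < degree m"
  proof (cases "s = 0")
    case False
    have "degree (map_poly \<sigma> s) \<le> degree s" by (rule degree_map_poly_le)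
    then show ?thesis using s(2) False degree_diff_le_max[of "map_poly \<sigma> s" s] by simp
  qed simp
  ultimately show ?thesis using dvd_imp_degree_le[of m "map_poly \<sigma> s - s"] by fastforce
qed

section \<open>Evaluating polynomials at a matrix\<close>

context
  fixes A :: "'a :: field mat" and n :: nat
  assumes A: "A \<in> carrier_mat n n"
begin

text \<open>Sums in the ring of matrices are computed entrywise; this turns \<open>poly_mat\<close> into a formula
for its entries.\<close>

lemma finsum_ring_mat_index:
  assumes "finite I" "\<And>k. k \<in> I \<Longrightarrow> f k \<in> carrier_mat n n"
  shows "finsum (ring_mat TYPE('a) n ()) f I \<in> carrier_mat n n \<and>
    (\<forall>i<n. \<forall>j<n. finsum (ring_mat TYPE('a) n ()) f I $$ (i, j) = (\<Sum>k\<in>I. f k $$ (i, j)))"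
  using assms
proof (induction I rule: finite_induct)
  case empty
  interpret ring "ring_mat TYPE('a) n ()" by (rule ring_mat)
  show ?case using finsum_empty by (auto simp: ring_mat_simps)
next
  case (insert x I)
  interpret ring "ring_mat TYPE('a) n ()" by (rule ring_mat)
  have "finsum (ring_mat TYPE('a) n ()) f (insert x I)
      = f x \<oplus>\<^bsub>ring_mat TYPE('a) n ()\<^esub> finsum (ring_mat TYPE('a) n ()) f I"
    by (rule finsum_insert) (use insert in \<open>auto simp: ring_mat_simps\<close>)
  then show ?case using insert by (auto simp: ring_mat_simps)
qed

lemma poly_mat_carrier: "poly_mat p A \<in> carrier_mat n n"
  and poly_mat_index:
    "i < n \<Longrightarrow> j < n \<Longrightarrow> poly_mat p A $$ (i, j) = (\<Sum>k\<le>degree p. coeff p k * (A ^\<^sub>m k) $$ (i, j))"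
proof -
  have *: "poly_mat p A = finsum (ring_mat TYPE('a) n ()) (\<lambda>k. coeff p k \<cdot>\<^sub>m (A ^\<^sub>m k)) {..degree p}"
    using A unfolding poly_mat_def by auto
  note f = finsum_ring_mat_index[of "{..degree p}" "\<lambda>k. coeff p k \<cdot>\<^sub>m (A ^\<^sub>m k)", folded *]
  have ca: "coeff p k \<cdot>\<^sub>m (A ^\<^sub>m k) \<in> carrier_mat n n" for k using A by auto
  show "poly_mat p A \<in> carrier_mat n n" using f ca by auto
  show "i < n \<Longrightarrow> j < n \<Longrightarrow> poly_mat p A $$ (i, j) = (\<Sum>k\<le>degree p. coeff p k * (A ^\<^sub>m k) $$ (i, j))"
    using f ca A by auto
qed

lemma poly_mat_dims: "dim_row (poly_mat p A) = n" "dim_col (poly_mat p A) = n"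
  using poly_mat_carrier by auto

text \<open>The summation range may be enlarged, which lets two polynomials of different degrees be
evaluated over a common range.\<close>

lemma poly_mat_index_bound:
  assumes "degree p \<le> N" "i < n" "j < n"
  shows "poly_mat p A $$ (i, j) = (\<Sum>k\<le>N. coeff p k * (A ^\<^sub>m k) $$ (i, j))"
  unfolding poly_mat_index[OF assms(2,3)]
  by (rule sum.mono_neutral_left) (use assms(1) in \<open>auto simp: coeff_eq_0\<close>)

lemma poly_mat_0: "poly_mat 0 A = 0\<^sub>m n n"
  by (rule eq_matI) (auto simp: poly_mat_dims poly_mat_index)

lemma poly_mat_add: "poly_mat (p + q) A = poly_mat p A + poly_mat q A"
proof (rule eq_matI)
  fix i j assume "i < dim_row (poly_mat p A + poly_mat q A)" "j < dim_col (poly_mat p A + poly_mat q A)"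
  then have ij: "i < n" "j < n" by (auto simp: poly_mat_dims)
  show "poly_mat (p + q) A $$ (i, j) = (poly_mat p A + poly_mat q A) $$ (i, j)"
    using ij poly_mat_dims
    by (simp add: poly_mat_index_bound[of _ "max (degree p) (degree q)"] degree_add_le_max
        sum.distrib ring_distribs)
qed (auto simp: poly_mat_dims)

lemma poly_mat_smult: "poly_mat (smult c p) A = c \<cdot>\<^sub>m poly_mat p A"
proof (rule eq_matI)
  fix i j assume "i < dim_row (c \<cdot>\<^sub>m poly_mat p A)" "j < dim_col (c \<cdot>\<^sub>m poly_mat p A)"
  then have ij: "i < n" "j < n" by (auto simp: poly_mat_dims)
  show "poly_mat (smult c p) A $$ (i, j) = (c \<cdot>\<^sub>m poly_mat p A) $$ (i, j)"
    using ij poly_mat_dims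
    by (simp add: poly_mat_index_bound[of _ "degree p"] sum_distrib_left mult.assoc)
qed (auto simp: poly_mat_dims)

lemma poly_mat_sum:
  assumes "finite I"
  shows "poly_mat (sum f I) A = finsum (ring_mat TYPE('a) n ()) (\<lambda>i. poly_mat (f i) A) I"
  using assms
proof (induction I rule: finite_induct)
  case empty
  interpret ring "ring_mat TYPE('a) n ()" by (rule ring_mat)
  show ?case using finsum_empty by (simp add: ring_mat_simps poly_mat_0)
next
  case (insert x I)
  interpret ring "ring_mat TYPE('a) n ()" by (rule ring_mat)
  have "finsum (ring_mat TYPE('a) n ()) (\<lambda>i. poly_mat (f i) A) (insert x I)
      = poly_mat (f x) A \<oplus>\<^bsub>ring_mat TYPE('a) n ()\<^esub> finsum (ring_mat TYPE('a) n ()) (\<lambda>i. poly_mat (f i) A) I"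
    by (rule finsum_insert) (use insert in \<open>auto simp: ring_mat_simps poly_mat_carrier\<close>)
  then show ?case using insert by (simp add: ring_mat_simps poly_mat_add)
qed

text \<open>Horner's rule. With it, the multiplicativity of evaluation follows by induction over the
coefficients.\<close>

lemma poly_mat_pCons: "poly_mat (pCons c p) A = c \<cdot>\<^sub>m 1\<^sub>m n + poly_mat p A * A"
proof (rule eq_matI)
  fix i j assume "i < dim_row (c \<cdot>\<^sub>m 1\<^sub>m n + poly_mat p A * A)"
    and "j < dim_col (c \<cdot>\<^sub>m 1\<^sub>m n + poly_mat p A * A)"
  then have ij: "i < n" "j < n" using A by (auto simp: poly_mat_dims)
  define N where "N = degree p"
  have "poly_mat (pCons c p) A $$ (i, j) = (\<Sum>k\<le>Suc N. coeff (pCons c p) k * (A ^\<^sub>m k) $$ (i, j))"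
    by (rule poly_mat_index_bound[OF _ ij]) (simp add: N_def degree_pCons_le)
  also have "\<dots> = c * (1\<^sub>m n) $$ (i, j) + (\<Sum>k\<le>N. coeff p k * (A ^\<^sub>m Suc k) $$ (i, j))"
    using A by (subst sum.atMost_Suc_shift) simp
  also have "(\<Sum>k\<le>N. coeff p k * (A ^\<^sub>m Suc k) $$ (i, j))
      = (\<Sum>k\<le>N. \<Sum>l<n. coeff p k * ((A ^\<^sub>m k) $$ (i, l) * A $$ (l, j)))"
    using A ij by (intro sum.cong refl)
      (auto simp: scalar_prod_def atLeast0LessThan sum_distrib_left)
  also have "\<dots> = (\<Sum>l<n. (\<Sum>k\<le>N. coeff p k * (A ^\<^sub>m k) $$ (i, l)) * A $$ (l, j))"
    by (subst sum.swap) (simp add: sum_distrib_right mult.assoc)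
  also have "\<dots> = (\<Sum>l<n. poly_mat p A $$ (i, l) * A $$ (l, j))"
    using ij by (intro sum.cong refl) (simp add: poly_mat_index N_def)
  also have "\<dots> = (poly_mat p A * A) $$ (i, j)"
    using A ij by (simp add: poly_mat_dims scalar_prod_def atLeast0LessThan)
  finally show "poly_mat (pCons c p) A $$ (i, j) = (c \<cdot>\<^sub>m 1\<^sub>m n + poly_mat p A * A) $$ (i, j)"
    using A ij poly_mat_dims by simp
qed (use A in \<open>auto simp: poly_mat_dims\<close>)

lemma poly_mat_const: "poly_mat [:c:] A = c \<cdot>\<^sub>m 1\<^sub>m n"
  using A by (simp add: poly_mat_pCons poly_mat_0)

lemma poly_mat_1: "poly_mat 1 A = 1\<^sub>m n"
proof -
  have "1 \<cdot>\<^sub>m (1\<^sub>m n :: 'a mat) = 1\<^sub>m n" by (rule eq_matI) auto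
  then show ?thesis using poly_mat_const[of 1] by (simp add: one_pCons)
qed

lemma poly_mat_X: "poly_mat [:0, 1:] A = A"
proof -
  have "poly_mat [:0, 1:] A = 0 \<cdot>\<^sub>m 1\<^sub>m n + poly_mat 1 A * A"
    using poly_mat_pCons[of 0 1] by (simp add: one_pCons)
  moreover have "0 \<cdot>\<^sub>m (1\<^sub>m n :: 'a mat) = 0\<^sub>m n n" by (rule eq_matI) auto
  ultimately show ?thesis using A by (simp add: poly_mat_1)
qed

lemma poly_mat_mult: "poly_mat (p * q) A = poly_mat p A * poly_mat q A"
proof (induction q rule: pCons_induct)
  case 0
  then show ?case using poly_mat_carrier[of p] by (simp add: poly_mat_0)
next
  case (pCons c q)
  have 0: "0 \<cdot>\<^sub>m (1\<^sub>m n :: 'a mat) = 0\<^sub>m n n" by (rule eq_matI) auto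
  have car: "poly_mat p A \<in> carrier_mat n n" "poly_mat q A \<in> carrier_mat n n" 
    using poly_mat_carrier by auto
  have "poly_mat (p * pCons c q) A = poly_mat (smult c p) A + poly_mat (pCons 0 (p * q)) A"
    by (simp add: poly_mat_add)
  also have "\<dots> = c \<cdot>\<^sub>m poly_mat p A + poly_mat p A * poly_mat q A * A"
    using A car pCons.IH by (simp add: poly_mat_smult poly_mat_pCons 0)
  also have "poly_mat p A * poly_mat q A * A = poly_mat p A * (poly_mat q A * A)"
    by (rule assoc_mult_mat[OF car A])
  also have "c \<cdot>\<^sub>m poly_mat p A = poly_mat p A * (c \<cdot>\<^sub>m 1\<^sub>m n)"
    using car by (simp add: mult_smult_distrib[OF car(1) one_carrier_mat])
  also have "poly_mat p A * (c \<cdot>\<^sub>m 1\<^sub>m n) + poly_mat p A * (poly_mat q A * A)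
      = poly_mat p A * (c \<cdot>\<^sub>m 1\<^sub>m n + poly_mat q A * A)"
    by (rule mult_add_distrib_mat[symmetric]) (use car A in auto)
  finally show ?case by (simp add: poly_mat_pCons)
qed

lemma poly_mat_commute: "poly_mat p A * poly_mat q A = poly_mat q A * poly_mat p A"
  by (metis poly_mat_mult mult.commute)

lemma poly_mat_power: "poly_mat (p ^ k) A = poly_mat p A ^\<^sub>m k"
  by (induction k) (auto simp: poly_mat_1 poly_mat_dims poly_mat_mult power_Suc2 simp del: power_Suc)

lemma poly_mat_diff: "poly_mat (p - q) A = poly_mat p A - poly_mat q A"
proof -
  have "poly_mat (p - q) A = poly_mat p A + (- 1) \<cdot>\<^sub>m poly_mat q A"
    using poly_mat_add[of p "smult (- 1) q"] poly_mat_smult[of "- 1" q] by simp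
  also have "\<dots> = poly_mat p A - poly_mat q A"
    by (rule eq_matI) (auto simp: poly_mat_dims)
  finally show ?thesis .
qed

lemma poly_mat_dvd_zero:
  assumes "p dvd q" "poly_mat p A = 0\<^sub>m n n"
  shows "poly_mat q A = 0\<^sub>m n n"
proof -
  obtain r where "q = p * r" using assms(1) by (elim dvdE)
  then show ?thesis using assms(2) poly_mat_carrier[of r] by (simp add: poly_mat_mult)
qed

end

lemma poly_mat_pcompose:
  fixes A :: "'a :: field mat"
  assumes A: "A \<in> carrier_mat n n"
  shows "poly_mat p (poly_mat s A) = poly_mat (pcompose p s) A"
proof (induction p rule: pCons_induct)
  case 0
  then show ?case by (simp add: poly_mat_0[OF A] poly_mat_0[OF poly_mat_carrier[OF A]])
next
  case (pCons c p)
  then show ?case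
    by (simp add: pcompose_pCons poly_mat_pCons[OF poly_mat_carrier[OF A]] poly_mat_add[OF A]
        poly_mat_mult[OF A] poly_mat_const[OF A] poly_mat_commute[OF A, of s])
qed

lemma poly_mat_map_to_ac:
  fixes A :: "'a :: field mat"
  assumes A: "A \<in> carrier_mat n n"
  shows "poly_mat (map_poly to_ac p) (map_mat to_ac A) = map_mat to_ac (poly_mat p A)"
proof -
  interpret to_ac: semiring_hom "to_ac :: 'a \<Rightarrow> 'a alg_closure" by unfold_locales auto
  have A': "map_mat to_ac A \<in> carrier_mat n n" using A by simp
  show ?thesis
  proof (induction p rule: pCons_induct)
    case 0
    show ?case using A A' by (auto simp: poly_mat_0[OF A] poly_mat_0[OF A'])
  next
    case (pCons c p)
    have "map_mat to_ac (poly_mat p A * A) = map_mat to_ac (poly_mat p A) * map_mat to_ac A"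
      by (rule to_ac.mat_hom_mult[OF poly_mat_carrier[OF A] A])
    moreover have "map_mat to_ac (c \<cdot>\<^sub>m 1\<^sub>m n + poly_mat p A * A)
        = to_ac c \<cdot>\<^sub>m 1\<^sub>m n + map_mat to_ac (poly_mat p A * A)"
      using A by (intro eq_matI) (auto simp: poly_mat_dims[OF A])
    ultimately show ?case using pCons.IH
      by (simp add: Polynomial.map_poly_pCons poly_mat_pCons[OF A'] poly_mat_pCons[OF A])
  qed
qed

section \<open>The minimal polynomial\<close>

text \<open>The \<open>n^2 + 1\<close> matrices \<open>A^0, ..., A^(n^2)\<close> live in a space of dimension \<open>n^2\<close>, so they are linearly
dependent. The dependency is read off from a vector in the kernel of a singular matrix.\<close>

lemma ex_annihilating_poly:
  fixes A :: "'a :: field mat"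
  assumes A: "A \<in> carrier_mat n n"
  shows "\<exists>p. p \<noteq> 0 \<and> poly_mat p A = 0\<^sub>m n n"
proof -
  define N where "N = Suc (n * n)"
  define W where "W = mat N N (\<lambda>(i, k). if i < n * n then (A ^\<^sub>m k) $$ (i div n, i mod n) else 0)"
  \<comment> \<open>Column \<open>k\<close> of \<open>W\<close> lists the entries of \<open>A^k\<close>; a zero row at the bottom makes \<open>W\<close> square and singular.\<close>
  have W: "W \<in> carrier_mat N N" by (simp add: W_def)
  have "det W = 0"
  proof -
    have "det W = (\<Sum>j<N. W $$ (n * n, j) * cofactor W (n * n) j)"
      by (rule laplace_expansion_row[OF W]) (simp add: N_def)
    also have "\<dots> = 0" by (rule sum.neutral) (auto simp: W_def N_def)
    finally show ?thesis .
  qed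
  then obtain v where v: "v \<in> carrier_vec N" "v \<noteq> 0\<^sub>v N" "W *\<^sub>v v = 0\<^sub>v N"
    using det_0_iff_vec_prod_zero_field[OF W] by auto
  define p where "p = (\<Sum>k<N. monom (v $ k) k)"
  have co: "coeff p k = (if k < N then v $ k else 0)" for k
    unfolding p_def by (simp add: coeff_sum sum.delta)
  have "p \<noteq> 0"
  proof
    assume "p = 0"
    then have "v $ k = 0" if "k < N" for k using co[of k] that by simp
    then have "v = 0\<^sub>v N" using v(1) by (intro eq_vecI) auto
    with v(2) show False by simp
  qed
  moreover have "poly_mat p A = 0\<^sub>m n n"
  proof (rule eq_matI)
    fix i j assume "i < dim_row (0\<^sub>m n n :: 'a mat)" "j < dim_col (0\<^sub>m n n :: 'a mat)"
    then have ij: "i < n" "j < n" by auto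
    define l where "l = i * n + j"
    have l: "l < n * n" "l div n = i" "l mod n = j"
      using ij mult_le_mono1[of "Suc i" n n] unfolding l_def by auto
    have deg: "degree p \<le> n * n" by (rule degree_le) (simp add: co N_def)
    have "poly_mat p A $$ (i, j) = (\<Sum>k\<le>n * n. coeff p k * (A ^\<^sub>m k) $$ (i, j))"
      by (rule poly_mat_index_bound[OF A deg ij])
    also have "\<dots> = (\<Sum>k<N. (A ^\<^sub>m k) $$ (i, j) * v $ k)"
      by (rule sum.cong) (auto simp: N_def co)
    also have "\<dots> = (W *\<^sub>v v) $ l" using v(1) l
      by (auto simp: W_def N_def scalar_prod_def atLeast0LessThan intro!: sum.cong)
    also have "\<dots> = 0" unfolding v(3) using l by (simp add: N_def)
    finally show "poly_mat p A $$ (i, j) = 0\<^sub>m n n $$ (i, j)" using ij by simp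
  qed (auto simp: poly_mat_dims[OF A])
  ultimately show ?thesis by blast
qed

text \<open>Two monic annihilating polynomials of least degree coincide, because their difference is annihilating
of smaller degree; hence the description by \<open>THE\<close> denotes the normalised polynomial of
least degree.\<close>

lemma minimal_polynomial:
  fixes A :: "'a :: field mat"
  assumes A: "A \<in> carrier_mat n n"
  shows "lead_coeff (minimal_polynomial A) = 1" "poly_mat (minimal_polynomial A) A = 0\<^sub>m n n"
proof -
  define Z where "Z = (\<lambda>q. q \<noteq> 0 \<and> poly_mat q A = 0\<^sub>m n n)"
  define P where "P = (\<lambda>p. lead_coeff p = 1 \<and> poly_mat p A = 0\<^sub>m n n \<and> (\<forall>q. Z q \<longrightarrow> degree p \<le> degree q))"
  have mp: "minimal_polynomial A = (THE p. P p)"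
    using A unfolding minimal_polynomial_def P_def Z_def by auto
  obtain p0 where p0: "Z p0" using ex_annihilating_poly[OF A] by (auto simp: Z_def)
  define p1 where "p1 = arg_min degree Z"
  have p1: "Z p1" "\<And>q. Z q \<Longrightarrow> degree p1 \<le> degree q"
    unfolding p1_def by (rule arg_min_natI[of Z, OF p0], rule arg_min_nat_le[of Z])
  define p where "p = smult (inverse (lead_coeff p1)) p1"
  have P: "P p" using p1 unfolding P_def Z_def p_def by (auto simp: poly_mat_smult[OF A])
  have "p' = p" if P': "P p'" for p'
  proof (rule ccontr)
    assume ne: "p' \<noteq> p"
    have Z: "Z p" "Z p'" using P P' by (auto simp: P_def Z_def)
    then have deg: "degree p' = degree p" using P P' unfolding P_def by (meson le_antisym)
    have "Z (p' - p)" using ne P P' by (auto simp: Z_def P_def poly_mat_diff[OF A])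
    then have "degree p \<le> degree (p' - p)" using P by (auto simp: P_def)
    moreover have "degree (p' - p) \<le> degree p" using deg degree_diff_le_max[of p' p] by simp
    ultimately have "lead_coeff (p' - p) = lead_coeff p' - lead_coeff p" using deg by simp
    also have "\<dots> = 0" using P P' by (auto simp: P_def)
    finally have "p' - p = 0" by (simp only: leading_coeff_0_iff)
    then show False using ne by simp
  qed
  with P have "P (minimal_polynomial A)" unfolding mp by (rule theI[of P])
  then show "lead_coeff (minimal_polynomial A) = 1" "poly_mat (minimal_polynomial A) A = 0\<^sub>m n n"
    by (auto simp: P_def)
qed

section \<open>Kernels of polynomials in a matrix\<close>

lemma poly_mat_mult_vec:
  fixes A :: "'a :: field mat"
  assumes "A \<in> carrier_mat n n" "v \<in> carrier_vec n"
  shows "poly_mat (p * q) A *\<^sub>v v = poly_mat p A *\<^sub>v (poly_mat q A *\<^sub>v v)"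
  unfolding poly_mat_mult[OF assms(1)]
  by (rule assoc_mult_mat_vec[OF poly_mat_carrier poly_mat_carrier]) (use assms in auto)

lemma poly_mat_const_vec:
  fixes A :: "'a :: field mat"
  assumes "A \<in> carrier_mat n n" "v \<in> carrier_vec n"
  shows "poly_mat [:c:] A *\<^sub>v v = c \<cdot>\<^sub>v v"
  unfolding poly_mat_const[OF assms(1)] using assms by (intro eq_vecI) auto

lemma poly_mat_dvd_kills:
  fixes A :: "'a :: field mat"
  assumes "A \<in> carrier_mat n n" "v \<in> carrier_vec n" "p dvd q" "poly_mat p A *\<^sub>v v = 0\<^sub>v n"
  shows "poly_mat q A *\<^sub>v v = 0\<^sub>v n"
proof -
  obtain r where "q = r * p" using assms(3) by (metis dvdE mult.commute)
  moreover have "poly_mat r A *\<^sub>v 0\<^sub>v n = 0\<^sub>v n"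
    using poly_mat_dims[OF assms(1)] by (intro eq_vecI) (auto simp: scalar_prod_def)
  ultimately show ?thesis using assms by (simp add: poly_mat_mult_vec)
qed

text \<open>On the kernel of \<open>p(A)\<close> a polynomial acts through its class modulo \<open>p\<close>; here that class is
a constant.\<close>

lemma poly_mat_congruent_vec:
  fixes A :: "'a :: field mat"
  assumes A: "A \<in> carrier_mat n n" and v: "v \<in> carrier_vec n"
    and "p dvd q - [:c:]" "poly_mat p A *\<^sub>v v = 0\<^sub>v n"
  shows "poly_mat q A *\<^sub>v v = c \<cdot>\<^sub>v v"
proof -
  have "poly_mat (q - [:c:] + [:c:]) A *\<^sub>v v = poly_mat (q - [:c:]) A *\<^sub>v v + poly_mat [:c:] A *\<^sub>v v"
    unfolding poly_mat_add[OF A] by (rule add_mult_distrib_mat_vec[OF poly_mat_carrier poly_mat_carrier v]) fact+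
  then show ?thesis
    using poly_mat_dvd_kills[OF A v assms(3,4)] v by (simp add: poly_mat_const_vec[OF A v])
qed

text \<open>The kernels of \<open>(A - a)^k\<close> and \<open>g(A)\<close> meet trivially when \<open>X - a\<close> does not divide \<open>g\<close>:
induction on \<open>k\<close> reduces to an eigenvector of \<open>A\<close>, on which \<open>g(A)\<close> acts as the nonzero
scalar \<open>g(a)\<close>.\<close>

lemma killed_by_coprime:
  fixes A :: "'a :: field mat"
  assumes A: "A \<in> carrier_mat n n"
    and "v \<in> carrier_vec n" "poly_mat ([:- a, 1:] ^ k) A *\<^sub>v v = 0\<^sub>v n"
    and "poly_mat g A *\<^sub>v v = 0\<^sub>v n" and ga: "poly g a \<noteq> 0"
  shows "v = 0\<^sub>v n"
  using assms(2-4)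
proof (induction k arbitrary: v)
  case 0
  then show ?case by (simp add: poly_mat_1[OF A])
next
  case (Suc k)
  let ?L = "[:- a, 1:]"
  define w where "w = poly_mat ?L A *\<^sub>v v"
  have w: "w \<in> carrier_vec n" unfolding w_def
    by (rule mult_mat_vec_carrier[OF poly_mat_carrier[OF A] Suc.prems(1)])
  have "poly_mat (?L ^ k) A *\<^sub>v w = 0\<^sub>v n"
    using Suc.prems(2) unfolding w_def power_Suc2 poly_mat_mult_vec[OF A Suc.prems(1)] .
  moreover have "poly_mat g A *\<^sub>v w = 0\<^sub>v n"
    unfolding w_def poly_mat_mult_vec[OF A Suc.prems(1), symmetric]
    by (rule poly_mat_dvd_kills[OF A Suc.prems(1) dvd_triv_left Suc.prems(3)])
  ultimately have "poly_mat ?L A *\<^sub>v v = 0\<^sub>v n" using Suc.IH[OF w] w_def by simp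
  moreover have "?L dvd g - [:poly g a:]" by (rule iffD1[OF poly_eq_0_iff_dvd]) simp
  ultimately have "poly_mat g A *\<^sub>v v = poly g a \<cdot>\<^sub>v v"
    using poly_mat_congruent_vec[OF A Suc.prems(1)] by blast
  then have "poly g a \<cdot>\<^sub>v v = 0\<^sub>v n" using Suc.prems(3) by simp
  then have z: "poly g a * v $ i = 0" if "i < n" for i
    using that Suc.prems(1) by (metis index_smult_vec(1) index_zero_vec(1) carrier_vecD)
  show ?case
    by (rule eq_vecI) (use Suc.prems(1) z ga in auto)
qed

section \<open>Diagonalisability\<close>

text \<open>A vector killed by a product of distinct linear factors in \<open>A\<close> is a sum of eigenvectors. Write the
product as \<open>(X - a) r\<close>. Then \<open>w = r(A) v\<close> is an eigenvector for \<open>a\<close>, on which \<open>r(A)\<close> acts as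
\<open>r(a) \<noteq> 0\<close>; subtracting \<open>w / r(a)\<close> from \<open>v\<close> leaves a vector killed by \<open>r(A)\<close>.\<close>

lemma (in vec_space) eigenvectors_span_if_split:
  assumes A: "A \<in> carrier_mat n n" and R: "finite R"
    and B: "B \<subseteq> carrier_vec n"
    and ev: "\<And>v c. v \<in> carrier_vec n \<Longrightarrow> A *\<^sub>v v = c \<cdot>\<^sub>v v \<Longrightarrow> v \<in> span B"
    and v: "v \<in> carrier_vec n" "poly_mat (\<Prod>a\<in>R. [:- a, 1:]) A *\<^sub>v v = 0\<^sub>v n"
  shows "v \<in> span B"
  using R v
proof (induction R arbitrary: v rule: finite_induct)
  case empty
  then have "A *\<^sub>v v = 0 \<cdot>\<^sub>v v" using A
    by (simp add: poly_mat_1[OF A]) (auto simp: scalar_prod_def)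
  then show ?case using ev empty by blast
next
  case (insert a R)
  define r where "r = (\<Prod>a\<in>R. [:- a, 1:])"
  have "poly r a \<noteq> 0" using insert.hyps by (auto simp: r_def poly_prod)
  then obtain c where c: "c * poly r a = 1" by (metis left_inverse)
  have prod: "(\<Prod>a\<in>insert a R. [:- a, 1:]) = [:- a, 1:] * r" using insert.hyps by (simp add: r_def)
  define w where "w = poly_mat r A *\<^sub>v v"
  have w: "w \<in> carrier_vec n" unfolding w_def
    by (rule mult_mat_vec_carrier[OF poly_mat_carrier[OF A] insert.prems(1)])
  have k: "poly_mat [:- a, 1:] A *\<^sub>v w = 0\<^sub>v n"
    using insert.prems unfolding w_def prod by (simp only: poly_mat_mult_vec[OF A])
  have "A *\<^sub>v w = poly_mat [:0, 1:] A *\<^sub>v w" by (simp add: poly_mat_X[OF A])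
  also have "\<dots> = a \<cdot>\<^sub>v w" by (rule poly_mat_congruent_vec[OF A w _ k]) simp
  finally have ws: "w \<in> span B" by (rule ev[OF w])
  have rw: "poly_mat r A *\<^sub>v w = poly r a \<cdot>\<^sub>v w"
    by (rule poly_mat_congruent_vec[OF A w _ k]) (rule iffD1[OF poly_eq_0_iff_dvd], simp)
  define u where "u = v + (- c) \<cdot>\<^sub>v w"
  have u: "u \<in> carrier_vec n" using insert.prems w by (simp add: u_def)
  have "poly_mat r A *\<^sub>v u = poly_mat r A *\<^sub>v v + poly_mat r A *\<^sub>v ((- c) \<cdot>\<^sub>v w)"
    unfolding u_def by (rule mult_add_distrib_mat_vec[OF poly_mat_carrier[OF A]]) (use insert.prems w in auto)
  also have "poly_mat r A *\<^sub>v ((- c) \<cdot>\<^sub>v w) = (- c) \<cdot>\<^sub>v (poly_mat r A *\<^sub>v w)"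
    by (rule mult_mat_vec[OF poly_mat_carrier[OF A] w])
  also have "\<dots> = - w" unfolding rw using c w by (intro eq_vecI) (auto simp: mult.assoc[symmetric])
  finally have "poly_mat r A *\<^sub>v u = 0\<^sub>v n" using w by (simp add: w_def[symmetric])
  then have us: "u \<in> span B" using insert.IH[OF u] by (simp add: r_def)
  have "v = u + c \<cdot>\<^sub>v w" unfolding u_def using insert.prems w by (intro eq_vecI) auto
  moreover have "c \<cdot>\<^sub>v w \<in> span B" by (rule smult_in_span[OF B ws])
  ultimately show ?case using span_add1[OF B us] by simp
qed

text \<open>A maximal linearly independent set of eigenvectors spans all eigenvectors, hence the whole space by
the preceding lemma. Its members are the columns of a matrix that conjugates \<open>A\<close> into diagonal form.\<close>

lemma diagonalisable_if_split:
  fixes A :: "'a :: field mat"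
  assumes A: "A \<in> carrier_mat n n" and R: "finite R"
    and kill: "poly_mat (\<Prod>a\<in>R. [:- a, 1:]) A = 0\<^sub>m n n"
  shows "\<exists>D. diagonal_mat D \<and> similar_mat A D"
proof -
  interpret V: vec_space "TYPE('a)" n .
  define E where "E = {v \<in> carrier_vec n. \<exists>c. A *\<^sub>v v = c \<cdot>\<^sub>v v}"
  define P where "P = (\<lambda>S. S \<subseteq> E \<and> \<not> V.lin_dep S)"
  have Ec: "E \<subseteq> carrier_vec n" by (auto simp: E_def)
  have "finite S \<and> card S \<le> n" if "P S" for S
    using V.li_le_dim[OF V.fin_dim, of S] that Ec V.dim_is_n by (auto simp: P_def)
  moreover have "P {}" by (simp add: P_def V.lin_dep_def)
  ultimately obtain B where fB: "finite B" and mB: "maximal B P"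
    using maximal_exists[of P n "{}"] by metis
  have BP: "P B" using mB unfolding maximal_def by blast
  have Bc: "B \<subseteq> carrier_vec n" and BE: "B \<subseteq> E" and Bli: "\<not> V.lin_dep B" using BP Ec by (auto simp: P_def)
  have ev: "v \<in> V.span B" if v: "v \<in> E" for v
  proof (rule ccontr)
    assume nv: "v \<notin> V.span B"
    have vB: "v \<notin> B" using nv V.in_own_span[of B] Bc by auto
    have "\<not> V.lin_dep (B \<union> {v})"
      using V.lin_dep_iff_in_span[of B v] Bc Bli v Ec vB nv by auto
    then have "P (B \<union> {v})" using BE v by (simp add: P_def)
    then have "B \<union> {v} = B" using mB unfolding maximal_def by blast
    with vB show False by blast
  qed
  have "carrier_vec n \<subseteq> V.span B"
  proof
    fix v :: "'a vec" assume v: "v \<in> carrier_vec n"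
    have "poly_mat (\<Prod>a\<in>R. [:- a, 1:]) A *\<^sub>v v = 0\<^sub>v n" unfolding kill using v by auto
    then show "v \<in> V.span B"
      using V.eigenvectors_span_if_split[OF A R Bc _ v] ev by (auto simp: E_def)
  qed
  then have "V.gen_set B" using V.span_closed[OF Bc] by auto
  then have "V.basis B" using Bli Bc by (simp add: V.basis_def)
  then have cB: "card B = n" using V.dim_basis[OF fB] V.dim_is_n by simp
  obtain ws where ws: "set ws = B" "distinct ws" using finite_distinct_list[OF fB] by blast
  have len: "length ws = n" using ws cB distinct_card by fastforce
  define Q where "Q = mat_of_cols n ws"
  have Q: "Q \<in> carrier_mat n n" unfolding Q_def using mat_of_cols_carrier(1)[of n ws] len by simp
  have cols: "cols Q = ws" unfolding Q_def by (rule cols_mat_of_cols) (use ws Bc in auto)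
  have "V.rank Q = n" by (rule V.lin_indpt_full_rank[OF Q]) (use cols ws Bli in auto)
  then have "det Q \<noteq> 0" using V.det_rank_iff[OF Q] by simp
  then obtain T where T: "T \<in> carrier_mat n n" "Q * T = 1\<^sub>m n" "T * Q = 1\<^sub>m n"
    using det_non_zero_imp_unit[OF Q] unfolding Units_def by (auto simp: ring_mat_simps)
  have "\<forall>v\<in>B. \<exists>c. A *\<^sub>v v = c \<cdot>\<^sub>v v" using BE by (auto simp: E_def)
  then obtain f where f: "\<And>v. v \<in> B \<Longrightarrow> A *\<^sub>v v = f v \<cdot>\<^sub>v v" by metis
  define D where "D = mat n n (\<lambda>(i, j). if i = j then f (ws ! i) else 0)"
  have D: "D \<in> carrier_mat n n" by (simp add: D_def)
  have AQ: "A * Q = Q * D"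
  proof (rule eq_matI)
    fix i j assume "i < dim_row (Q * D)" "j < dim_col (Q * D)"
    then have ij: "i < n" "j < n" using Q D by auto
    have cj: "col Q j = ws ! j" using cols ij len Q by (metis cols_nth carrier_matD(2))
    have wj: "ws ! j \<in> B" "ws ! j \<in> carrier_vec n" using ws len ij Bc by auto
    have "(A * Q) $$ (i, j) = (A *\<^sub>v col Q j) $ i" using A Q ij by simp
    also have "\<dots> = f (ws ! j) * (ws ! j) $ i" unfolding cj f[OF wj(1)] using wj ij by simp
    also have "(ws ! j) $ i = Q $$ (i, j)" using cj Q ij by (metis index_col carrier_matD)
    also have "f (ws ! j) * Q $$ (i, j) = (\<Sum>k<n. Q $$ (i, k) * D $$ (k, j))"
    proof -
      have "(\<Sum>k<n. Q $$ (i, k) * D $$ (k, j)) = (\<Sum>k<n. if k = j then Q $$ (i, k) * f (ws ! j) else 0)"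
        by (rule sum.cong) (auto simp: D_def ij)
      then show ?thesis using ij by (simp add: mult.commute)
    qed
    also have "\<dots> = (Q * D) $$ (i, j)" using Q D ij by (simp add: scalar_prod_def atLeast0LessThan)
    finally show "(A * Q) $$ (i, j) = (Q * D) $$ (i, j)" .
  qed (use A Q D in auto)
  have "A = A * (Q * T)" using A T by simp
  also have "\<dots> = Q * D * T" using AQ assoc_mult_mat[OF A Q T(1)] by simp
  finally have "similar_mat A D" using A Q D T by (intro similar_matI[of _ _ Q T n]) auto
  moreover have "diagonal_mat D" by (simp add: D_def diagonal_mat_def)
  ultimately show ?thesis by blast
qed

section \<open>Uniqueness of the semisimple part\<close>

text \<open>\<open>N\<close> preserves the eigenspaces of \<open>S\<close>, since the two commute, and on the eigenspace for \<open>a\<close> the matrix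
\<open>A - a = (S - a) + N\<close> agrees with \<open>N\<close>.\<close>

lemma shifted_power_on_eigenvector:
  fixes A S N :: "'a :: field mat"
  assumes S: "S \<in> carrier_mat n n" and N: "N \<in> carrier_mat n n"
    and comm: "S * N = N * S" and A: "A = S + N"
    and v: "v \<in> carrier_vec n" and ev: "S *\<^sub>v v = a \<cdot>\<^sub>v v"
  shows "poly_mat ([:- a, 1:] ^ j) A *\<^sub>v v = (N ^\<^sub>m j) *\<^sub>v v"
  using v ev
proof (induction j arbitrary: v)
  case 0
  have "A \<in> carrier_mat n n" using A S N by simp
  then show ?case using N by (simp add: poly_mat_1)
next
  case (Suc j)
  have Ac: "A \<in> carrier_mat n n" using A S N by simp
  have Nv: "N *\<^sub>v v \<in> carrier_vec n" using N Suc.prems by simp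
  have "poly_mat [:- a, 1:] A *\<^sub>v v = poly_mat ([:0, 1:] + [:- a:]) A *\<^sub>v v" by simp
  also have "\<dots> = A *\<^sub>v v + (- a) \<cdot>\<^sub>v v"
    unfolding poly_mat_add[OF Ac] poly_mat_X[OF Ac] 
      add_mult_distrib_mat_vec[OF Ac poly_mat_carrier[OF Ac] Suc.prems(1)]
      poly_mat_const_vec[OF Ac Suc.prems(1)] ..
  also have "A *\<^sub>v v = a \<cdot>\<^sub>v v + N *\<^sub>v v"
    unfolding A add_mult_distrib_mat_vec[OF S N Suc.prems(1)] Suc.prems(2) ..
  also have "a \<cdot>\<^sub>v v + N *\<^sub>v v + (- a) \<cdot>\<^sub>v v = N *\<^sub>v v"
    using Suc.prems(1) Nv N by (intro eq_vecI) auto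
  finally have L: "poly_mat [:- a, 1:] A *\<^sub>v v = N *\<^sub>v v" .
  have "S *\<^sub>v (N *\<^sub>v v) = N *\<^sub>v (S *\<^sub>v v)"
    using comm assoc_mult_mat_vec[OF S N Suc.prems(1)] assoc_mult_mat_vec[OF N S Suc.prems(1)] by simp
  also have "\<dots> = a \<cdot>\<^sub>v (N *\<^sub>v v)"
    unfolding Suc.prems(2) by (rule mult_mat_vec[OF N Suc.prems(1)])
  finally have IH: "poly_mat ([:- a, 1:] ^ j) A *\<^sub>v (N *\<^sub>v v) = (N ^\<^sub>m j) *\<^sub>v (N *\<^sub>v v)"
    by (rule Suc.IH[OF Nv])
  show ?case
    unfolding power_Suc2 poly_mat_mult_vec[OF Ac Suc.prems(1)] L IH pow_mat.simps
    by (rule assoc_mult_mat_vec[symmetric, OF pow_carrier_mat[OF N] N Suc.prems(1)])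
qed

text \<open>Let \<open>v\<close> be an eigenvector of \<open>S\<close> for \<open>a\<close>. A power of \<open>A - a\<close>
acts on it as a power of \<open>N\<close>, hence kills it; as \<open>m(A)\<close> kills it too, already \<open>(A - a) ^ order a m\<close>
kills it. Modulo this power \<open>s\<close> is the constant \<open>a\<close>, so \<open>s(A) v = a v = S v\<close>. The eigenvectors of the
diagonalisable matrix \<open>S\<close> span, so \<open>S = s(A)\<close>.\<close>

lemma semisimple_part_unique:
  fixes A S N D :: "'a :: field mat"
  assumes S: "S \<in> carrier_mat n n" and N: "N \<in> carrier_mat n n"
    and comm: "S * N = N * S" and A: "A = S + N"
    and nil: "N ^\<^sub>m k = 0\<^sub>m n n" and D: "diagonal_mat D" and sim: "similar_mat S D"
    and m: "poly_mat m A = 0\<^sub>m n n"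
    and cong: "\<And>a. poly m a = 0 \<Longrightarrow> [:- a, 1:] ^ order a m dvd s - [:a:]" and m0: "m \<noteq> 0"
  shows "S = poly_mat s A"
proof -
  have Ac: "A \<in> carrier_mat n n" using A S N by simp
  have eig: "poly_mat s A *\<^sub>v v = a \<cdot>\<^sub>v v" if v: "v \<in> carrier_vec n" and ev: "S *\<^sub>v v = a \<cdot>\<^sub>v v" for v a
  proof -
    let ?L = "[:- a, 1:]"
    define h where "h = order a m"
    define w where "w = poly_mat (?L ^ h) A *\<^sub>v v"
    have w: "w \<in> carrier_vec n" unfolding w_def
      by (rule mult_mat_vec_carrier[OF poly_mat_carrier[OF Ac] v])
    have k: "poly_mat (?L ^ k) A *\<^sub>v v = 0\<^sub>v n"
      unfolding shifted_power_on_eigenvector[OF S N comm A v ev] nil using v by auto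
    have kw: "poly_mat (?L ^ k) A *\<^sub>v w = 0\<^sub>v n"
      unfolding w_def poly_mat_mult_vec[OF Ac v, symmetric]
      by (rule poly_mat_dvd_kills[OF Ac v _ k]) simp
    obtain G where G: "m = ?L ^ h * G" "\<not> ?L dvd G"
      using order_decomp[OF m0, of a] unfolding h_def by blast
    have "poly_mat G A *\<^sub>v w = poly_mat m A *\<^sub>v v"
      unfolding w_def poly_mat_mult_vec[OF Ac v, symmetric] G(1) by (simp add: mult.commute)
    also have "\<dots> = 0\<^sub>v n" unfolding m using v by auto
    finally have "w = 0\<^sub>v n"
      using killed_by_coprime[OF Ac w kw] G(2) by (simp add: poly_eq_0_iff_dvd)
    then have z: "poly_mat (?L ^ h) A *\<^sub>v v = 0\<^sub>v n" by (simp add: w_def)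
    \<comment> \<open>If \<open>a\<close> is not a root of \<open>m\<close>, then \<open>h = 0\<close> and the congruence is trivial.\<close>
    have "?L ^ h dvd s - [:a:]"
      using cong[of a] by (cases "poly m a = 0") (simp_all add: h_def order_0I)
    then show ?thesis by (rule poly_mat_congruent_vec[OF Ac v _ z])
  qed
  obtain P T where w: "similar_mat_wit S D P T" using sim unfolding similar_mat_def by blast
  have P: "P \<in> carrier_mat n n" and T: "T \<in> carrier_mat n n" and Dc: "D \<in> carrier_mat n n"
    and PT: "P * T = 1\<^sub>m n" and TP: "T * P = 1\<^sub>m n" and SP: "S = P * D * T"
    using similar_mat_witD2[OF S w] by auto
  have "S * P = P * D * (T * P)" unfolding SP
    by (rule assoc_mult_mat[OF mult_carrier_mat[OF P Dc] T P])
  then have SPD: "S * P = P * D" using TP right_mult_one_mat[OF mult_carrier_mat[OF P Dc]] by simp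
  have X: "poly_mat s A \<in> carrier_mat n n" by (rule poly_mat_carrier[OF Ac])
  have "S * P = poly_mat s A * P"
  proof (rule eq_matI)
    fix i j assume "i < dim_row (poly_mat s A * P)" "j < dim_col (poly_mat s A * P)"
    then have ij: "i < n" "j < n" using X P by auto
    have c: "col P j \<in> carrier_vec n" using P by (intro carrier_vecI) simp
    have "S *\<^sub>v col P j = D $$ (j, j) \<cdot>\<^sub>v col P j"
    proof (rule eq_vecI)
      fix l assume "l < dim_vec (D $$ (j, j) \<cdot>\<^sub>v col P j)"
      then have l: "l < n" using P by simp
      have "(S *\<^sub>v col P j) $ l = (P * D) $$ (l, j)" using SPD S P l ij
        by (metis carrier_matD index_mult_mat(1) index_mult_mat_vec)
      also have "\<dots> = (\<Sum>k<n. P $$ (l, k) * D $$ (k, j))"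
        using P Dc l ij by (simp add: scalar_prod_def atLeast0LessThan)
      also have "\<dots> = (\<Sum>k<n. if k = j then P $$ (l, k) * D $$ (j, j) else 0)"
        using D Dc ij by (intro sum.cong) (auto simp: diagonal_mat_def)
      also have "\<dots> = (D $$ (j, j) \<cdot>\<^sub>v col P j) $ l" using P l ij by (simp add: mult.commute)
      finally show "(S *\<^sub>v col P j) $ l = (D $$ (j, j) \<cdot>\<^sub>v col P j) $ l" .
    qed (use S P in auto)
    then have "S *\<^sub>v col P j = poly_mat s A *\<^sub>v col P j" using eig[OF c] by simp
    then show "(S * P) $$ (i, j) = (poly_mat s A * P) $$ (i, j)"
      using S P X ij by (metis carrier_matD index_mult_mat(1) index_mult_mat_vec)
  qed (use S P X in auto)
  then have "S * P * T = poly_mat s A * P * T" by simp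
  then show ?thesis
    unfolding assoc_mult_mat[OF S P T] assoc_mult_mat[OF X P T] PT using S X by simp
qed

section \<open>Adjunction and the field \<open>K_dagger\<close>\<close>

interpretation to_ac_hom: inj_idom_hom "to_ac :: 'a :: field \<Rightarrow> 'a alg_closure"
  by unfold_locales auto

interpretation to_ac_poly_hom: map_poly_inj_idom_hom "to_ac :: 'a :: field \<Rightarrow> 'a alg_closure" ..

lemma poly_map_to_ac_hom_mult:
  "poly (map_poly to_ac (p * q)) x = poly (map_poly to_ac p) x * poly (map_poly to_ac q) x"
  by (simp add: to_ac_poly_hom.hom_mult)

lemma adjoin_subfield: "is_subfield (adjoin T)"
proof -
  let ?R = "ring_of_type_algebra :: 'a alg_closure ring"
  interpret R: field ?R by rule
  have ops: "one ?R = 1" "zero ?R = 0" "add ?R a b = a + b" "monoid.mult ?R a b = a * b" "a \<in> carrier ?R" for a b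
    by (auto simp: ring_of_type_algebra_def)
  have neg: "a_inv ?R a = - a" for a
    using R.l_neg[of a] by (simp add: ops eq_neg_iff_add_eq_0)
  have inv: "m_inv ?R a = inverse a" if "a \<noteq> 0" for a
    using R.Units_l_inv[of a] that by (simp add: ops R.field_Units inverse_unique mult.commute)
  note g = generate_field.intros[where R = ?R and H = "range to_ac \<union> T"]
  have "0 \<in> adjoin T" unfolding adjoin_def using R.zero_in_generate by (simp add: ops)
  moreover have "inverse x \<in> adjoin T" if "x \<in> adjoin T" "x \<noteq> 0" for x
    using g(4)[of x] that by (simp add: adjoin_def inv ops)
  ultimately have "inverse x \<in> adjoin T" if "x \<in> adjoin T" for x
    using that by (cases "x = 0") auto
  then show ?thesis using g(1,3,5,6) by (auto simp: is_subfield_def adjoin_def ops neg)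
qed

lemma adjoin_incl: "to_ac x \<in> adjoin T" "T \<subseteq> adjoin T"
  unfolding adjoin_def by (auto intro: generate_field.incl)

lemma adjoin_mono:
  assumes "T \<subseteq> Y" shows "adjoin T \<subseteq> adjoin Y"
proof -
  interpret R: field "ring_of_type_algebra :: 'a alg_closure ring" by rule
  show ?thesis unfolding adjoin_def using assms
    by (intro R.mono_generate_field) (auto simp: ring_of_type_algebra_def)
qed

lemma map_poly_to_ac_over: "map_poly to_ac p \<in> polys_over (adjoin T)"
  by (auto simp: coeff_map_poly adjoin_incl)

lemma automorphism_endo:
  assumes "\<sigma> \<in> automorphisms_over_base F" shows "field_endo F \<sigma>"
  using assms unfolding automorphisms_over_base_def field_endo_def ring_iso_def Ring.ring_hom_def
  by (auto simp: ring_of_type_algebra_def bij_betw_def)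

text \<open>As a subfield containing the entries of the given matrix, \<open>K_dagger M\<close> contains the entries of every
polynomial in it whose coefficients lie in \<open>K_dagger M\<close>.\<close>

lemma K_dagger_is_subfield: "is_subfield (K_dagger M)"
proof -
  define F where "F = splitting_field (minimal_polynomial M)"
  have F: "is_subfield F" unfolding F_def splitting_field_def by (rule adjoin_subfield)
  note c = is_subfield_closed[OF F]
  have K: "K_dagger M = {x \<in> F. \<forall>\<sigma>\<in>automorphisms_over_base F. \<sigma> x = x}"
    by (simp add: K_dagger_def F_def Let_def)
  note e = field_endo_simps[OF F automorphism_endo]
  have inv: "\<sigma> (inverse x) = inverse x" if "\<sigma> \<in> automorphisms_over_base F" "x \<in> F" "\<sigma> x = x" for \<sigma> x
  proof (cases "x = 0")
    case False
    have "\<sigma> (x * inverse x) = \<sigma> x * \<sigma> (inverse x)"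
      by (rule e(4)) (use that c in auto)
    then have "x * \<sigma> (inverse x) = 1" using that False e(2)[OF that(1)] by simp
    then show ?thesis by (metis inverse_unique)
  qed (use that in auto)
  show ?thesis unfolding is_subfield_def K by (auto simp: c e inv)
qed

lemma to_ac_in_K_dagger: "to_ac x \<in> K_dagger M"
  unfolding K_dagger_def Let_def splitting_field_def automorphisms_over_base_def
  using adjoin_incl by auto

section \<open>Roots of the irreducible factors\<close>

text \<open>The minimal polynomial of \<open>a\<close> over the base field, obtained as a polynomial of least degree
vanishing at \<open>a\<close>.\<close>

lemma ex_irreducible_with_root:
  fixes m :: "'a :: field poly"
  assumes "m \<noteq> 0" "a \<in> roots_ac m"
  shows "\<exists>q. irreducible q \<and> lead_coeff q = 1 \<and> (\<forall>p. a \<in> roots_ac p \<longleftrightarrow> q dvd p)"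
proof -
  define Z where "Z = (\<lambda>p. p \<noteq> 0 \<and> a \<in> roots_ac p)"
  define d where "d = arg_min degree Z"
  have Zm: "Z m" using assms by (simp add: Z_def)
  have d: "Z d" "\<And>q. Z q \<Longrightarrow> degree d \<le> degree q"
    unfolding d_def by (rule arg_min_natI[of Z, OF Zm], rule arg_min_nat_le[of Z])
  have d0: "d \<noteq> 0" using d by (simp add: Z_def)
  have mult: "a \<in> roots_ac (p * q) \<longleftrightarrow> a \<in> roots_ac p \<or> a \<in> roots_ac q" for p q :: "'a poly"
    by (simp add: roots_ac_def poly_map_to_ac_hom_mult)
  have dvd: "d dvd p" if "a \<in> roots_ac p" for p
  proof -
    have "a \<in> roots_ac (p - p div d * d)"
      using that d(1) by (simp add: Z_def roots_ac_def to_ac_poly_hom.hom_minus poly_map_to_ac_hom_mult)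
    then have "a \<in> roots_ac (p mod d)" by (simp only: minus_div_mult_eq_mod)
    then have "p mod d = 0"
      using d(2)[of "p mod d"] degree_mod_less[OF d0, of p] unfolding Z_def by linarith
    then show ?thesis by (rule mod_0_imp_dvd)
  qed
  have irr: "irreducible d"
  proof (rule irreducibleI[OF d0])
    show "\<not> d dvd 1" 
    proof
      assume "d dvd 1"
      then obtain r where "1 = d * r" by (elim dvdE)
      then have "a \<in> roots_ac 1" using mult[of d r] d(1) by (simp add: Z_def)
      then show False by (simp add: roots_ac_def)
    qed
    fix p q assume pq: "d = p * q"
    have ne: "p \<noteq> 0" "q \<noteq> 0" using pq d0 by auto
    have deg: "degree d = degree p + degree q" unfolding pq by (rule degree_mult_eq[OF ne])
    have "Z p \<or> Z q" using mult[of p q] pq d(1) ne by (simp add: Z_def)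
    then have "degree d \<le> degree p \<or> degree d \<le> degree q" using d(2) by blast
    then have "degree p = 0 \<or> degree q = 0" using deg by auto
    then show "p dvd 1 \<or> q dvd 1" using ne by (auto simp: is_unit_iff_degree)
  qed
  define c where "c = inverse (lead_coeff d)"
  have c: "c \<noteq> 0" using d0 by (simp add: c_def)
  define q where "q = smult c d"
  have "q = [:c:] * d" "is_unit [:c:]" using c by (simp_all add: q_def is_unit_const_poly_iff)
  then have "irreducible q" using irr by (simp only: irreducible_mult_unit_left)
  moreover have "lead_coeff q = 1" using d0 by (simp add: q_def c_def)
  moreover have "a \<in> roots_ac p \<longleftrightarrow> q dvd p" for p
  proof
    assume "a \<in> roots_ac p"
    then show "q dvd p" using dvd c by (simp add: q_def smult_dvd_iff)
  next
    assume "q dvd p"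
    then have "d dvd p" using c by (simp add: q_def smult_dvd_iff)
    then obtain r where "p = d * r" by (elim dvdE)
    then show "a \<in> roots_ac p" using mult[of d r] d(1) by (simp add: Z_def)
  qed
  ultimately show ?thesis by blast
qed

text \<open>Distinct monic irreducible polynomials have no common root, since both equal the minimal polynomial
of such a root.\<close>

lemma irreducible_with_root_unique:
  fixes p q :: "'a :: field poly"
  assumes "irreducible p" "lead_coeff p = 1" "a \<in> roots_ac p"
    and "irreducible q" "lead_coeff q = 1" "a \<in> roots_ac q"
  shows "p = q"
proof -
  have p0: "p \<noteq> 0" using assms(2) by auto
  obtain d where d: "irreducible d" "lead_coeff d = 1" "\<And>p. a \<in> roots_ac p \<longleftrightarrow> d dvd p"
    using ex_irreducible_with_root[OF p0 assms(3)] by blast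
  have eq: "r = d" if r: "irreducible r" "lead_coeff r = 1" "a \<in> roots_ac r" for r
  proof -
    obtain k where k: "r = d * k" using d(3) r(3) by (metis dvdE)
    have "\<not> d dvd 1" using d(1) by (rule irreducible_not_unit)
    then have "k dvd 1" using irreducibleD[OF r(1) k] by blast
    moreover have "k \<noteq> 0" using k r(2) by auto
    ultimately have "degree k = 0" using is_unit_iff_degree[of k] by simp
    then obtain c where "k = [:c:]" by (rule degree_eq_zeroE)
    then have r': "r = smult c d" using k by simp
    then have "c = 1" using r(2) d(2) unfolding r' lead_coeff_smult by simp
    then show ?thesis using r' by simp
  qed
  show ?thesis using eq assms by metis
qed

text \<open>The index pairs \<open>(q, a)\<close> are parametrised by their second component: \<open>factor_at M a\<close> is the only
irreducible factor that can be paired with the root \<open>a\<close>.\<close>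

definition factor_at :: "'a :: field mat \<Rightarrow> 'a alg_closure \<Rightarrow> 'a poly" where
  "factor_at M a = (THE q. q \<in> min_factors M \<and> a \<in> roots_ac q)"

context
  fixes M :: "'a :: field mat"
  assumes m0: "minimal_polynomial M \<noteq> 0"
begin

lemma min_factors_root:
  assumes "q \<in> min_factors M" "a \<in> roots_ac q"
  shows "a \<in> roots_ac (minimal_polynomial M)" "q = factor_at M a"
proof -
  obtain k where "minimal_polynomial M = q * k" using assms by (auto simp: min_factors_def dvd_def)
  then show "a \<in> roots_ac (minimal_polynomial M)"
    using assms(2) by (simp add: roots_ac_def poly_map_to_ac_hom_mult)
  show "q = factor_at M a" unfolding factor_at_def
    by (rule the_equality[symmetric])
      (use assms in \<open>auto simp: min_factors_def intro: irreducible_with_root_unique\<close>)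
qed

lemma factor_at:
  assumes "a \<in> roots_ac (minimal_polynomial M)"
  shows "factor_at M a \<in> min_factors M" "a \<in> roots_ac (factor_at M a)"
proof -
  obtain q where q: "irreducible q" "lead_coeff q = 1" "\<And>p. a \<in> roots_ac p \<longleftrightarrow> q dvd p"
    using ex_irreducible_with_root[OF m0 assms] by blast
  have "q \<in> min_factors M" "a \<in> roots_ac q" using q assms by (auto simp: min_factors_def)
  then show "factor_at M a \<in> min_factors M" "a \<in> roots_ac (factor_at M a)"
    using min_factors_root(2) by auto
qed

lemma finite_roots_ac: "p \<noteq> 0 \<Longrightarrow> finite (roots_ac (p :: 'a poly))"
  unfolding roots_ac_def by (rule poly_roots_finite) simp

lemma finite_roots_factor: "q \<in> min_factors M \<Longrightarrow> finite (roots_ac q)"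
  by (rule finite_roots_ac) (auto simp: min_factors_def)

lemma min_factors_image: "min_factors M = factor_at M ` roots_ac (minimal_polynomial M)"
proof
  show "factor_at M ` roots_ac (minimal_polynomial M) \<subseteq> min_factors M" using factor_at(1) by auto
  show "min_factors M \<subseteq> factor_at M ` roots_ac (minimal_polynomial M)"
  proof
    fix q assume q: "q \<in> min_factors M"
    then have "\<not> q dvd 1" "q \<noteq> 0" by (auto simp: min_factors_def irreducible_not_unit)
    then have "degree (map_poly to_ac q) > 0" by (simp add: is_unit_iff_degree)
    then obtain a where "poly (map_poly to_ac q) a = 0" using alg_closed_imp_poly_has_root by blast
    then have "a \<in> roots_ac q" by (simp add: roots_ac_def)
    then show "q \<in> factor_at M ` roots_ac (minimal_polynomial M)" using min_factors_root[OF q] by blast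
  qed
qed

lemma finite_min_factors: "finite (min_factors M)"
  unfolding min_factors_image using finite_roots_ac[OF m0] by simp

text \<open>The double sums of the decomposition become sums over the distinct roots of the minimal polynomial in
the closure.\<close>

lemma sum_over_factor_roots:
  "(\<Sum>q\<in>min_factors M. \<Sum>a\<in>roots_ac q. f q a) = (\<Sum>a\<in>roots_ac (minimal_polynomial M). f (factor_at M a) a)"
proof -
  have "(\<Sum>q\<in>min_factors M. \<Sum>a\<in>roots_ac q. f q a) = (\<Sum>(q, a)\<in>(SIGMA q:min_factors M. roots_ac q). f q a)"
    by (rule sum.Sigma[OF finite_min_factors]) (simp add: finite_roots_factor)
  also have "\<dots> = (\<Sum>a\<in>roots_ac (minimal_polynomial M). f (factor_at M a) a)"
  proof (rule sum.reindex_bij_witness[of _ "\<lambda>a. (factor_at M a, a)" snd])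
    fix x assume "x \<in> (SIGMA q:min_factors M. roots_ac q)"
    then obtain q a where x: "x = (q, a)" "q \<in> min_factors M" "a \<in> roots_ac q" by auto
    note min_factors_root[OF x(2,3)]
    then show "(factor_at M (snd x), snd x) = x" "snd x \<in> roots_ac (minimal_polynomial M)"
      "f (factor_at M (snd x)) (snd x) = (case x of (q, a) \<Rightarrow> f q a)" using x(1) by auto
  qed (use factor_at in auto)
  finally show ?thesis .
qed

end

section \<open>The Chinese remainder decomposition\<close>

context
  fixes M :: "'a :: field mat" and m :: "'a poly" and mc :: "'a alg_closure poly"
    and R :: "'a alg_closure set"
  defines "m \<equiv> minimal_polynomial M" and "mc \<equiv> map_poly to_ac m" and "R \<equiv> roots_ac m"
  assumes m0: "minimal_polynomial M \<noteq> 0"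
begin

lemma mc0: "mc \<noteq> 0"
  using m0 by (simp add: mc_def m_def)

lemma R_iff: "a \<in> R \<longleftrightarrow> poly mc a = 0"
  by (simp add: R_def mc_def roots_ac_def)

lemma finite_R: "finite R"
  unfolding R_def m_def by (rule finite_roots_ac[OF m0 m0])

lemma eta_order: "eta M a = order a mc"
  by (simp add: eta_def mc_def m_def)

lemma eta_pos: "a \<in> R \<Longrightarrow> eta M a > 0"
  using mc0 R_iff by (simp add: eta_order order_gt_0_iff)

lemma G_poly_factor: "mc = [:- a, 1:] ^ eta M a * G_poly M a"
  unfolding G_poly_def eta_order mc_def[symmetric] m_def[symmetric]
  using order_1[of a mc] by simp

lemma G_poly_degree: "degree (G_poly M a) + eta M a = degree mc"
proof -
  have "G_poly M a \<noteq> 0" using G_poly_factor[of a] mc0 by auto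
  then have "degree mc = degree ([:- a, 1:] ^ eta M a) + degree (G_poly M a)"
    by (subst G_poly_factor[of a], intro degree_mult_eq) auto
  then show ?thesis by (simp add: degree_power_eq)
qed

lemma G_poly_nonroot: "poly (G_poly M a) a \<noteq> 0"
proof
  assume "poly (G_poly M a) a = 0"
  then have "[:- a, 1:] dvd G_poly M a" by (simp add: poly_eq_0_iff_dvd)
  then have "[:- a, 1:] ^ Suc (eta M a) dvd [:- a, 1:] ^ eta M a * G_poly M a"
    by (simp only: power_Suc2 mult_dvd_mono dvd_refl)
  then show False using order_2[OF mc0, of a] unfolding eta_order[symmetric] G_poly_factor[symmetric] by simp
qed

text \<open>This is why the summands of \<open>\<Sum>b a * G_poly M a\<close> do not interact: all but one vanish modulo a given
\<open>(X - a) ^ eta M a\<close>.\<close>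

lemma G_poly_other:
  assumes "a \<noteq> b" shows "[:- a, 1:] ^ eta M a dvd G_poly M b"
proof -
  have "order a mc = order a ([:- b, 1:] ^ eta M b) + order a (G_poly M b)"
    using order_mult[of "[:- b, 1:] ^ eta M b" "G_poly M b" a] mc0 G_poly_factor[of b] by simp
  also have "order a ([:- b, 1:] ^ eta M b) = 0" by (rule order_0I) (use assms in simp)
  finally show ?thesis using order_1[of a "G_poly M b"] by (simp add: eta_order)
qed

lemma dvd_sum_others:
  assumes "a \<in> R"
  shows "[:- a, 1:] ^ eta M a dvd (\<Sum>b\<in>R. f b * G_poly M b) - f a * G_poly M a"
proof -
  have "(\<Sum>b\<in>R. f b * G_poly M b) - f a * G_poly M a = (\<Sum>b\<in>R - {a}. f b * G_poly M b)"
    using assms finite_R by (simp add: sum.remove[of R a])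
  moreover have "[:- a, 1:] ^ eta M a dvd \<dots>"
    by (intro dvd_sum dvd_mult G_poly_other) auto
  ultimately show ?thesis by simp
qed

text \<open>The conditions on the family \<open>B\<close>, apart from the coefficient fields, after reindexing by roots. They
determine the family: modulo \<open>(X - a) ^ eta M a\<close> they say that \<open>b a\<close> inverts \<open>G_poly M a\<close>.\<close>

definition local_inverses :: "('a alg_closure \<Rightarrow> 'a alg_closure poly) \<Rightarrow> bool" where
  "local_inverses b \<longleftrightarrow> (\<forall>a\<in>R. degree (b a) < eta M a) \<and> (\<Sum>a\<in>R. b a * G_poly M a) = 1"

lemma local_inverses_cong:
  assumes "local_inverses b" "a \<in> R"
  shows "[:- a, 1:] ^ eta M a dvd b a * G_poly M a - 1"
  using dvd_sum_others[OF assms(2), of b] assms(1) unfolding local_inverses_def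
  by (metis dvd_minus_iff minus_diff_eq)

lemma local_inverses_unique:
  assumes "local_inverses b" "local_inverses c" "a \<in> R"
  shows "b a = c a"
proof (rule ccontr)
  assume ne: "b a \<noteq> c a"
  have "[:- a, 1:] ^ eta M a dvd (b a * G_poly M a - 1) - (c a * G_poly M a - 1)"
    using assms by (intro dvd_diff local_inverses_cong)
  then have d: "[:- a, 1:] ^ eta M a dvd (b a - c a) * G_poly M a" by (simp add: algebra_simps)
  have G0: "G_poly M a \<noteq> 0" using G_poly_nonroot[of a] by auto
  have "eta M a \<le> order a ((b a - c a) * G_poly M a)"
    using d ne G0 unfolding order_divides by simp
  also have "\<dots> = order a (b a - c a)"
    using order_mult[of "b a - c a" "G_poly M a" a] ne G0 G_poly_nonroot[of a] by (simp add: order_0I)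
  also have "\<dots> \<le> degree (b a - c a)" using ne by (intro order_degree) simp
  also have "\<dots> < eta M a"
  proof -
    have "degree (b a) < eta M a" "degree (c a) < eta M a"
      using assms unfolding local_inverses_def by blast+
    then show ?thesis using degree_diff_le_max[of "b a" "c a"] by linarith
  qed
  finally show False by simp
qed

lemma degree_mult_G_poly:
  assumes "degree p < eta M a" shows "degree (p * G_poly M a) < degree mc"
  using degree_mult_le[of p "G_poly M a"] G_poly_degree[of a] assms by linarith

text \<open>Choosing \<open>b a\<close> as an inverse of \<open>G_poly M a\<close> modulo \<open>(X - a) ^ eta M a\<close> makes the sum congruent to \<open>1\<close> at
every root, hence modulo the whole polynomial; by the degree bounds it then equals \<open>1\<close>. If there
are no roots, as for matrices of size zero, the sum is empty and cannot be \<open>1\<close>.\<close>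

lemma ex_local_inverses:
  assumes "R \<noteq> {}"
  shows "\<exists>b. local_inverses b \<and> (\<forall>a\<in>R. b a \<in> polys_over (adjoin (roots_ac (factor_at M a))))"
proof -
  have "\<forall>a\<in>R. \<exists>B. B \<in> polys_over (adjoin (roots_ac (factor_at M a))) \<and>
      degree B < eta M a \<and> [:- a, 1:] ^ eta M a dvd B * G_poly M a - 1"
  proof (intro ballI inverse_mod_linear_power[OF adjoin_subfield _ _ G_poly_nonroot, unfolded Bex_def])
    fix a assume a: "a \<in> R"
    show "eta M a > 0" by (rule eta_pos[OF a])
    let ?F = "adjoin (roots_ac (factor_at M a))"
    show aF: "a \<in> ?F"
      using factor_at(2)[OF m0] a adjoin_incl(2) by (auto simp: R_def m_def)
    show "G_poly M a \<in> polys_over ?F"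
      unfolding G_poly_def
      by (rule conjunct1[OF polys_over_div_mod[OF adjoin_subfield
              polys_over_linear_power[OF adjoin_subfield aF] map_poly_to_ac_over]])
  qed
  from bchoice[OF this] obtain b where b: "\<And>a. a \<in> R \<Longrightarrow> b a \<in> polys_over (adjoin (roots_ac (factor_at M a)))"
    "\<And>a. a \<in> R \<Longrightarrow> degree (b a) < eta M a"
    "\<And>a. a \<in> R \<Longrightarrow> [:- a, 1:] ^ eta M a dvd b a * G_poly M a - 1"
    by blast
  define E where "E = (\<Sum>a\<in>R. b a * G_poly M a) - 1"
  have "mc dvd E"
  proof (rule dvd_if_order_le[OF mc0])
    fix a
    show "[:- a, 1:] ^ order a mc dvd E"
    proof (cases "a \<in> R")
      case True
      have "[:- a, 1:] ^ eta M a dvd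
          ((\<Sum>a\<in>R. b a * G_poly M a) - b a * G_poly M a) + (b a * G_poly M a - 1)"
        by (rule dvd_add[OF dvd_sum_others[OF True] b(3)[OF True]])
      then show ?thesis by (simp add: E_def eta_order)
    next
      case False
      then show ?thesis by (simp add: R_iff order_0I)
    qed
  qed
  moreover have "degree E < degree mc"
  proof -
    obtain a where "a \<in> R" using assms by blast
    then have pos: "degree mc > 0" by (rule le_less_trans[OF le0 degree_mult_G_poly[OF b(2)]])
    have "degree (\<Sum>a\<in>R. b a * G_poly M a) < degree mc"
      by (rule degree_sum_less[OF _ pos]) (rule degree_mult_G_poly[OF b(2)])
    then show ?thesis unfolding E_def using pos degree_diff_le_max[of "\<Sum>a\<in>R. b a * G_poly M a" 1] by simp
  qed
  ultimately have "E = 0" using dvd_imp_degree_le[of mc E] by (meson not_le)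
  then have "local_inverses b" using b(2) by (simp add: local_inverses_def E_def)
  with b(1) show ?thesis by blast
qed

text \<open>Existence and uniqueness of local inverses identify the family described by \<open>THE\<close> in \<open>B_poly\<close>.\<close>

lemma B_poly:
  assumes "R \<noteq> {}"
  shows "local_inverses (\<lambda>a. B_poly M (factor_at M a) a)"
    and "a \<in> R \<Longrightarrow> B_poly M (factor_at M a) a \<in> polys_over (adjoin (roots_ac (factor_at M a)))"
proof -
  define P where "P = (\<lambda>B.
     (\<forall>q \<in> min_factors M. \<forall>\<alpha> \<in> roots_ac q.
        (\<forall>k. coeff (B q \<alpha>) k \<in> adjoin (roots_ac q)) \<and> degree (B q \<alpha>) < eta M \<alpha>) \<and>
     (\<Sum>q \<in> min_factors M. \<Sum>\<alpha> \<in> roots_ac q. B q \<alpha> * G_poly M \<alpha>) = 1 \<and>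
     (\<forall>q \<alpha>. \<not> (q \<in> min_factors M \<and> \<alpha> \<in> roots_ac q) \<longrightarrow> B q \<alpha> = 0))"
  have Bd: "B_poly M = (THE B. P B)" unfolding B_poly_def P_def ..
  have R: "R = roots_ac (minimal_polynomial M)" by (simp only: R_def m_def)
  have idx: "q \<in> min_factors M \<and> a \<in> roots_ac q \<longleftrightarrow> a \<in> R \<and> q = factor_at M a" for q a
    unfolding R using min_factors_root[OF m0, of q a] factor_at[OF m0, of a] by metis
  have all: "(\<forall>q\<in>min_factors M. \<forall>a\<in>roots_ac q. Q q a) \<longleftrightarrow> (\<forall>a\<in>R. Q (factor_at M a) a)" for Q
  proof
    assume *: "\<forall>q\<in>min_factors M. \<forall>a\<in>roots_ac q. Q q a"
    show "\<forall>a\<in>R. Q (factor_at M a) a"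
    proof
      fix a assume "a \<in> R"
      then have "factor_at M a \<in> min_factors M \<and> a \<in> roots_ac (factor_at M a)" using idx by blast
      then show "Q (factor_at M a) a" using * by blast
    qed
  next
    assume *: "\<forall>a\<in>R. Q (factor_at M a) a"
    show "\<forall>q\<in>min_factors M. \<forall>a\<in>roots_ac q. Q q a"
    proof (intro ballI)
      fix q a assume "q \<in> min_factors M" "a \<in> roots_ac q"
      then have "a \<in> R \<and> q = factor_at M a" using idx by blast
      then show "Q q a" using * by simp
    qed
  qed
  have P_iff: "P B \<longleftrightarrow> local_inverses (\<lambda>a. B (factor_at M a) a)
      \<and> (\<forall>a\<in>R. B (factor_at M a) a \<in> polys_over (adjoin (roots_ac (factor_at M a))))
      \<and> (\<forall>q a. \<not> (a \<in> R \<and> q = factor_at M a) \<longrightarrow> B q a = 0)" for B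
    unfolding P_def local_inverses_def sum_over_factor_roots[OF m0] idx all R[symmetric] mem_Collect_eq
      ball_conj_distrib by (simp only: conj_ac)
  obtain b where b: "local_inverses b" "\<forall>a\<in>R. b a \<in> polys_over (adjoin (roots_ac (factor_at M a)))"
    using ex_local_inverses[OF assms] by blast
  define B where "B = (\<lambda>q a. if a \<in> R \<and> q = factor_at M a then b a else 0)"
  have PB: "P B" unfolding P_iff using b by (auto simp: B_def local_inverses_def)
  have "B' = B" if "P B'" for B'
  proof (intro ext)
    fix q a
    show "B' q a = B q a"
    proof (cases "a \<in> R \<and> q = factor_at M a")
      case True
      then show ?thesis using that PB local_inverses_unique[of "\<lambda>a. B' (factor_at M a) a" "\<lambda>a. B (factor_at M a) a" a]
        unfolding P_iff by simp
    next
      case False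
      then show ?thesis using that PB unfolding P_iff by metis
    qed
  qed
  with PB have "P (B_poly M)" unfolding Bd by (rule theI[of P])
  then show "local_inverses (\<lambda>a. B_poly M (factor_at M a) a)"
    and "a \<in> R \<Longrightarrow> B_poly M (factor_at M a) a \<in> polys_over (adjoin (roots_ac (factor_at M a)))"
    unfolding P_iff by auto
qed

text \<open>The polynomial whose value at the matrix is \<open>S_part M\<close>. It is the solution
of least degree of the congruences \<open>s \<equiv> a\<close> modulo \<open>(X - a) ^ eta M a\<close> at the roots \<open>a\<close>.\<close>

definition s_poly :: "'a alg_closure poly" where
  "s_poly = (\<Sum>a\<in>R. smult a (C_poly M (factor_at M a) a))"

lemma s_poly_alt: "s_poly = (\<Sum>a\<in>R. smult a (B_poly M (factor_at M a) a) * G_poly M a)"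
  by (simp add: s_poly_def C_poly_def)

lemma s_poly_cong:
  assumes a: "a \<in> R"
  shows "[:- a, 1:] ^ eta M a dvd s_poly - [:a:]"
proof -
  have "R \<noteq> {}" using a by blast
  then have "[:- a, 1:] ^ eta M a dvd smult a (B_poly M (factor_at M a) a * G_poly M a - 1)"
    using local_inverses_cong[OF B_poly(1) a] by (simp add: dvd_smult)
  then have "[:- a, 1:] ^ eta M a dvd 
      (s_poly - smult a (B_poly M (factor_at M a) a) * G_poly M a) + smult a (B_poly M (factor_at M a) a * G_poly M a - 1)"
    unfolding s_poly_alt by (intro dvd_add dvd_sum_others[OF a])
  moreover have "(s_poly - smult a (B_poly M (factor_at M a) a) * G_poly M a)
      + smult a (B_poly M (factor_at M a) a * G_poly M a - 1) = s_poly - [:a:]"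
    by (simp add: smult_diff_right)
  ultimately show ?thesis by (simp only:)
qed

lemma s_poly_degree: "s_poly = 0 \<or> degree s_poly < degree mc"
proof (cases "R = {}")
  case False
  then obtain a where a: "a \<in> R" by blast
  have d: "degree (smult a (B_poly M (factor_at M a) a) * G_poly M a) < degree mc" if a: "a \<in> R" for a
  proof (rule degree_mult_G_poly)
    have "degree (B_poly M (factor_at M a) a) < eta M a"
      using B_poly(1)[OF False] a unfolding local_inverses_def by blast
    then show "degree (smult a (B_poly M (factor_at M a) a)) < eta M a"
      by (rule le_less_trans[OF degree_smult_le])
  qed
  have "degree s_poly < degree mc" unfolding s_poly_alt
    by (rule degree_sum_less[OF d le_less_trans[OF le0 d[OF a]]])
  then show ?thesis by simp
qed (simp add: s_poly_def)

lemma s_poly_over_splitting_field: "s_poly \<in> polys_over (splitting_field m)"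
proof (cases "R = {}")
  case True
  then show ?thesis using is_subfield_closed(1)[OF adjoin_subfield]
    by (simp add: s_poly_def splitting_field_def)
next
  case False
  let ?F = "splitting_field m"
  have F: "is_subfield ?F" unfolding splitting_field_def by (rule adjoin_subfield)
  have RF: "R \<subseteq> ?F" unfolding splitting_field_def R_def by (rule adjoin_incl)
  show ?thesis unfolding s_poly_alt
  proof (rule polys_over_sum[OF F])
    fix a assume a: "a \<in> R"
    have sub: "roots_ac (factor_at M a) \<subseteq> roots_ac m"
      using min_factors_root(1)[OF m0 factor_at(1)[OF m0]] a unfolding R_def m_def by blast
    have "B_poly M (factor_at M a) a \<in> polys_over ?F"
      using B_poly(2)[OF False a] adjoin_mono[OF sub] unfolding splitting_field_def mem_Collect_eq by blast
    moreover have "G_poly M a \<in> polys_over ?F"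
      unfolding G_poly_def splitting_field_def
      by (rule conjunct1[OF polys_over_div_mod[OF adjoin_subfield
              polys_over_linear_power[OF adjoin_subfield] map_poly_to_ac_over]])
        (use RF a in \<open>auto simp: splitting_field_def\<close>)
    ultimately show "smult a (B_poly M (factor_at M a) a) * G_poly M a \<in> polys_over ?F"
      using subsetD[OF RF a] by (intro polys_over_closed(6,7)[OF F])
  qed
qed

text \<open>Together with the degree bound the congruences determine \<open>s_poly\<close>, and every automorphism of the splitting
field over the base field permutes them.\<close>

lemma s_poly_over_K_dagger: "s_poly \<in> polys_over (K_dagger M)"
proof -
  let ?F = "splitting_field m"
  have F: "is_subfield ?F" unfolding splitting_field_def by (rule adjoin_subfield)
  have "coeff s_poly k \<in> K_dagger M" for k
  proof -
    have "\<sigma> (coeff s_poly k) = coeff s_poly k" if \<sigma>: "\<sigma> \<in> automorphisms_over_base ?F" for \<sigma>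
    proof -
      note e = automorphism_endo[OF \<sigma>]
      have s0: "\<sigma> 0 = 0" by (rule field_endo_simps(1)[OF F e])
      have "map_poly \<sigma> s_poly = s_poly"
      proof (rule fixed_by_endo[OF F e])
        show "mc \<in> polys_over ?F" unfolding mc_def splitting_field_def by (rule map_poly_to_ac_over)
        show "map_poly \<sigma> mc = mc" unfolding mc_def using \<sigma> s0
          by (intro poly_eqI) (simp add: coeff_map_poly automorphisms_over_base_def)
        show "{a. poly mc a = 0} \<subseteq> ?F"
          using adjoin_incl(2)[of R] R_iff unfolding splitting_field_def R_def by auto
        show "[:- a, 1:] ^ order a mc dvd s_poly - [:a:]" if "poly mc a = 0" for a
          using s_poly_cong[of a] that by (simp add: R_iff eta_order)
      qed (fact mc0 s_poly_over_splitting_field s_poly_degree)+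
      then show ?thesis using coeff_map_poly[of \<sigma> s_poly k] s0 by simp
    qed
    moreover have "coeff s_poly k \<in> ?F" using s_poly_over_splitting_field by blast
    ultimately show ?thesis unfolding K_dagger_def Let_def m_def[symmetric] by blast
  qed
  then show ?thesis by blast
qed

lemma S_part_eq:
  assumes M: "M \<in> carrier_mat n n"
  shows "S_part M = poly_mat s_poly (map_mat to_ac M)"
proof -
  let ?A = "map_mat to_ac M"
  let ?R = "ring_mat TYPE('a alg_closure) n ()"
  have A: "?A \<in> carrier_mat n n" using M by simp
  interpret R: ring ?R by (rule ring_mat)
  let ?t = "\<lambda>q a. smult a (C_poly M q a)"
  have "S_part M = finsum ?R (\<lambda>q. finsum ?R (\<lambda>a. poly_mat (?t q a) ?A) (roots_ac q)) (min_factors M)"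
    using M unfolding S_part_def Let_def poly_mat_smult[OF A] by simp
  also have "\<dots> = finsum ?R (\<lambda>q. poly_mat (\<Sum>a\<in>roots_ac q. ?t q a) ?A) (min_factors M)"
  proof (rule R.finsum_cong'[OF refl])
    show "(\<lambda>q. poly_mat (\<Sum>a\<in>roots_ac q. ?t q a) ?A) \<in> min_factors M \<rightarrow> carrier ?R"
      by (simp add: ring_mat_simps poly_mat_carrier[OF A])
    fix q assume "q \<in> min_factors M"
    then show "finsum ?R (\<lambda>a. poly_mat (?t q a) ?A) (roots_ac q) = poly_mat (\<Sum>a\<in>roots_ac q. ?t q a) ?A"
      by (intro poly_mat_sum[OF A, symmetric] finite_roots_factor[OF m0])
  qed
  also have "\<dots> = poly_mat (\<Sum>q\<in>min_factors M. \<Sum>a\<in>roots_ac q. ?t q a) ?A"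
    by (rule poly_mat_sum[OF A finite_min_factors[OF m0], symmetric])
  also have "(\<Sum>q\<in>min_factors M. \<Sum>a\<in>roots_ac q. ?t q a) = s_poly"
    unfolding sum_over_factor_roots[OF m0] s_poly_def R_def m_def ..
  finally show ?thesis .
qed

text \<open>Nilpotency of \<open>N_part M\<close>, stated for polynomials: \<open>X - s\<close> vanishes at every root \<open>a\<close>, as \<open>s \<equiv> a\<close> modulo
\<open>X - a\<close>. No multiplicity exceeds \<open>degree mc\<close>, so that power suffices.\<close>

lemma mc_dvd_power: "mc dvd ([:0, 1:] - s_poly) ^ degree mc"
proof (rule dvd_if_order_le[OF mc0])
  fix a
  show "[:- a, 1:] ^ order a mc dvd ([:0, 1:] - s_poly) ^ degree mc"
  proof (cases "a \<in> R")
    case True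
    have "[:- a, 1:] dvd [:- a, 1:] ^ eta M a" using eta_pos[OF True] by (simp add: dvd_power)
    then have "[:- a, 1:] dvd s_poly - [:a:]" using s_poly_cong[OF True] by (rule dvd_trans)
    then have "[:- a, 1:] dvd [:- a, 1:] - (s_poly - [:a:])" by (rule dvd_diff[OF dvd_refl])
    moreover have "[:- a, 1:] - (s_poly - [:a:]) = [:0, 1:] - s_poly" by (simp add: algebra_simps)
    ultimately have "[:- a, 1:] ^ degree mc dvd ([:0, 1:] - s_poly) ^ degree mc"
      by (simp add: dvd_power_same)
    then show ?thesis by (rule dvd_trans[OF le_imp_power_dvd[OF order_degree[OF mc0]]])
  next
    case False
    then show ?thesis by (simp add: R_iff order_0I)
  qed
qed

text \<open>Semisimplicity of \<open>S_part M\<close>, stated for polynomials: the matrix \<open>s(A)\<close> is a zero of the product of the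
distinct linear factors, because the factor \<open>s - a\<close> absorbs the full power \<open>(X - a) ^ order a mc\<close>.\<close>

lemma mc_dvd_pcompose: "mc dvd pcompose (\<Prod>a\<in>R. [:- a, 1:]) s_poly"
proof (rule dvd_if_order_le[OF mc0])
  fix a
  have eq: "pcompose (\<Prod>a\<in>R. [:- a, 1:]) s_poly = (\<Prod>a\<in>R. s_poly - [:a:])"
    unfolding pcompose_prod by (rule prod.cong) (simp_all add: pcompose_pCons)
  show "[:- a, 1:] ^ order a mc dvd pcompose (\<Prod>a\<in>R. [:- a, 1:]) s_poly"
  proof (cases "a \<in> R")
    case True
    have "[:- a, 1:] ^ order a mc dvd s_poly - [:a:]" using s_poly_cong[OF True] by (simp add: eta_order)
    also have "\<dots> dvd (\<Prod>a\<in>R. s_poly - [:a:])" by (rule dvd_prodI[OF finite_R True])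
    finally show ?thesis unfolding eq .
  next
    case False
    then show ?thesis by (simp add: R_iff order_0I)
  qed
qed

end

section \<open>The decomposition\<close>

lemma elements_poly_mat:
  fixes A :: "'a :: field mat"
  assumes A: "A \<in> carrier_mat n n" and F: "is_subfield F"
    and "elements_mat A \<subseteq> F" and p: "p \<in> polys_over F"
  shows "elements_mat (poly_mat p A) \<subseteq> F"
proof -
  note c = is_subfield_closed[OF F]
  have el: "A $$ (i, j) \<in> F" if "i < n" "j < n" for i j
    using assms(3) A that by (auto intro: elements_matI)
  have pow: "(A ^\<^sub>m k) $$ (i, j) \<in> F" if "i < n" "j < n" for i j k
    using that
  proof (induction k arbitrary: i j)
    case 0
    then show ?case using A c by auto
  next
    case (Suc k)
    have "(A ^\<^sub>m Suc k) $$ (i, j) = (\<Sum>l<n. (A ^\<^sub>m k) $$ (i, l) * A $$ (l, j))"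
      using A Suc.prems by (simp add: scalar_prod_def atLeast0LessThan)
    also have "\<dots> \<in> F" using Suc el c by (intro is_subfield_sum[OF F]) auto
    finally show ?case .
  qed
  show ?thesis
  proof
    fix x assume "x \<in> elements_mat (poly_mat p A)"
    then obtain i j where ij: "i < n" "j < n" "x = poly_mat p A $$ (i, j)"
      using poly_mat_dims[OF A] by fastforce
    show "x \<in> F" unfolding ij(3) poly_mat_index[OF A ij(1,2)]
      using p pow ij c by (intro is_subfield_sum[OF F]) auto
  qed
qed

theorem theorem1p6:
  fixes M :: "'a :: field mat" and n :: nat
  assumes "M \<in> carrier_mat n n"
  shows "(\<exists>p. (\<forall>k. Polynomial.coeff p k \<in> K_dagger M) \<and> S_part M = poly_mat p (map_mat to_ac M))
    \<and> (\<exists>p. (\<forall>k. Polynomial.coeff p k \<in> K_dagger M) \<and> N_part M = poly_mat p (map_mat to_ac M))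
    \<and> elements_mat (S_part M) \<subseteq> K_dagger M
    \<and> elements_mat (N_part M) \<subseteq> K_dagger M
    \<and> semisimple_mat (S_part M)
    \<and> nilpotent_mat (N_part M)
    \<and> S_part M * N_part M = N_part M * S_part M
    \<and> map_mat to_ac M = S_part M + N_part M
    \<and> (\<forall>S \<in> carrier_mat n n. \<forall>N \<in> carrier_mat n n.
         semisimple_mat S \<and> nilpotent_mat N \<and> S * N = N * S \<and> map_mat to_ac M = S + N
           \<longrightarrow> S = S_part M \<and> N = N_part M)"
proof -
  let ?A = "map_mat to_ac M"
  have A: "?A \<in> carrier_mat n n" using assms by simp
  have m0: "minimal_polynomial M \<noteq> 0" using minimal_polynomial(1)[OF assms] by auto
  define mc where "mc = map_poly to_ac (minimal_polynomial M)"
  define R where "R = roots_ac (minimal_polynomial M)"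
  have mcA: "poly_mat mc ?A = 0\<^sub>m n n"
    unfolding mc_def poly_mat_map_to_ac[OF assms] minimal_polynomial(2)[OF assms] by auto
  define s where "s = s_poly M"
  define t where "t = [:0, 1:] - s"
  have S: "S_part M = poly_mat s ?A" unfolding s_def by (rule S_part_eq[OF m0 assms])
  have N: "N_part M = poly_mat t ?A"
    unfolding N_part_def S t_def poly_mat_diff[OF A] poly_mat_X[OF A] ..
  note K = K_dagger_is_subfield[of M]
  have sK: "s \<in> polys_over (K_dagger M)" unfolding s_def by (rule s_poly_over_K_dagger[OF m0])
  have tK: "t \<in> polys_over (K_dagger M)" unfolding t_def
    by (rule polys_over_closed(5)[OF K _ sK]) (intro polys_over_closed(2,3)[OF K] is_subfield_closed[OF K])
  have AK: "elements_mat ?A \<subseteq> K_dagger M" using to_ac_in_K_dagger by auto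
  have sum: "?A = S_part M + N_part M"
    unfolding N_part_def S using A by (intro eq_matI) (auto simp: poly_mat_dims[OF A])
  have "poly_mat (\<Prod>a\<in>R. [:- a, 1:]) (poly_mat s ?A) = 0\<^sub>m n n"
    unfolding poly_mat_pcompose[OF A]
    using poly_mat_dvd_zero[OF A mc_dvd_pcompose[OF m0, folded mc_def R_def s_def] mcA] .
  moreover have "finite R" unfolding R_def by (rule finite_R[OF m0])
  ultimately have ss: "semisimple_mat (S_part M)"
    unfolding semisimple_mat_def S by (intro diagonalisable_if_split[OF poly_mat_carrier[OF A]])
  have "N_part M ^\<^sub>m degree mc = 0\<^sub>m n n"
    unfolding N poly_mat_power[OF A, symmetric] t_def
    by (rule poly_mat_dvd_zero[OF A mc_dvd_power[OF m0, folded mc_def s_def] mcA])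
  then have nil: "nilpotent_mat (N_part M)"
    unfolding nilpotent_mat_def using poly_mat_dims[OF A, of t] by (auto simp: N)
  have uniq: "S' = S_part M \<and> N' = N_part M"
    if c: "S' \<in> carrier_mat n n" "N' \<in> carrier_mat n n" and h: "semisimple_mat S'" "nilpotent_mat N'"
      "S' * N' = N' * S'" "?A = S' + N'" for S' N'
  proof -
    obtain k where k: "N' ^\<^sub>m k = 0\<^sub>m n n" using h(2) c(2) by (auto simp: nilpotent_mat_def)
    obtain D where D: "diagonal_mat D" "similar_mat S' D" using h(1) by (auto simp: semisimple_mat_def)
    have eq: "S' = poly_mat s ?A"
    proof (rule semisimple_part_unique[OF c h(3,4) k D mcA])
      show "mc \<noteq> 0" unfolding mc_def by (rule mc0[OF m0])
      show "[:- a, 1:] ^ order a mc dvd s - [:a:]" if "poly mc a = 0" for a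
        using s_poly_cong[OF m0, of a] that
        by (simp add: R_iff[OF m0] eta_order[OF m0] mc_def s_def)
    qed
    moreover have "N' = ?A - S'" unfolding h(4) using c by (intro eq_matI) auto
    ultimately show ?thesis by (simp add: S N_part_def)
  qed
  show ?thesis
  proof (intro conjI ballI impI)
    show "\<exists>p. (\<forall>k. coeff p k \<in> K_dagger M) \<and> S_part M = poly_mat p ?A"
      by (rule exI[of _ s]) (use sK S in simp)
    show "\<exists>p. (\<forall>k. coeff p k \<in> K_dagger M) \<and> N_part M = poly_mat p ?A"
      by (rule exI[of _ t]) (use tK N in simp)
    show "elements_mat (S_part M) \<subseteq> K_dagger M" unfolding S by (rule elements_poly_mat[OF A K AK sK])
    show "elements_mat (N_part M) \<subseteq> K_dagger M" unfolding N by (rule elements_poly_mat[OF A K AK tK])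
    show "S_part M * N_part M = N_part M * S_part M" unfolding S N by (rule poly_mat_commute[OF A])
  qed (use ss nil sum uniq in blast)+
qed

end
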